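(* Let $\alpha\in[0,1)$ and let $p$ be a probability mass function on $\mathbb{N}$ with $p_j\lesssim j^{-1/\alpha}$. Let $\hat H(\mathbf{X}_n)$ be the harmonic entropy estimator computed from an i.i.d. sample of size $n$ from $p$. Then there is a constant $C>0$ not depending on $n$ such that for all $n\ge1$ $$\mathbb{E}\left[\left(\hat H(\mathbf{X}_n)-H(X)\right)^2\right]\le C\left(\frac{1}{n^{2(1-\alpha)}}+\frac1n\right).$$
   Context: $\mathbb{N}=\{1,2,3,\dots\}$ and $\log$ is the natural logarithm. For a probability mass function $p$ on $\mathbb{N}$ write $p_j=p(j)$; $X$ is a random variable with mass function $p$, with Shannon entropy $H(X)=-\mathbb{E}[\log p(X)]$. $J(m)=\sum_{k=1}^m 1/k$ is the $m$-th harmonic number, $J(0)=0$. Given an i.i.d. sample $\mathbf{X}_n=\{X^{(1)},\dots,X^{(n)}\}$ from $p$, let $m^{(i)}=\sum_{k=1}^n I(X^{(k)}=X^{(i)})$. The harmonic entropy estimator is $$\hat H(\mathbf{X}_n)=\frac1n\sum_{i=1}^n\left[J(n-1)-J\left(m^{(i)}-1\right)\right].$$ Tail condition: for $\alpha\in(0,1)$, $p_j\lesssim j^{-1/\alpha}$ means there is a constant $C_0$ with $p_j\le C_0 j^{-1/\alpha}$ for all $j\in\mathbb{N}$. By convention, for $\alpha=0$ the condition means that the tail decays faster than any power law: $p_j=o(j^{-1/\beta})$ as $j\to\infty$ for every $\beta\in(0,1)$. *)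

theory Defs
  imports "HOL-Probability.Probability"
begin

text \<open>A probability mass function on \<open>{1, 2, 3, \<dots>}\<close> is a \<^typ>\<open>nat pmf\<close> whose support avoids 0.\<close>
definition pmf_on_positives :: "nat pmf \<Rightarrow> bool" where
  "pmf_on_positives p \<longleftrightarrow> set_pmf p \<subseteq> {1..}"

definition shannon_entropy :: "nat pmf \<Rightarrow> real" where
  "shannon_entropy p = - measure_pmf.expectation p (\<lambda>x. ln (pmf p x))"

text \<open>The case \<open>\<alpha> = 0\<close> is a convention: decay faster than any power law.\<close>
definition tail_condition :: "real \<Rightarrow> nat pmf \<Rightarrow> bool" where
  "tail_condition \<alpha> p \<longleftrightarrow>
     (if \<alpha> = 0
      then \<forall>\<beta>. 0 < \<beta> \<and> \<beta> < 1 \<longrightarrow> (\<lambda>j. pmf p j) \<in> o(\<lambda>j. real j powr (- 1 / \<beta>))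
      else \<exists>C0::real. \<forall>j\<ge>1. pmf p j \<le> C0 * real j powr (- 1 / \<alpha>))"

definition iid_sample :: "'a measure \<Rightarrow> nat pmf \<Rightarrow> nat \<Rightarrow> (nat \<Rightarrow> 'a \<Rightarrow> nat) \<Rightarrow> bool" where
  "iid_sample M p n X \<longleftrightarrow>
     prob_space M \<and>
     prob_space.indep_vars M (\<lambda>_. count_space UNIV) X {1..n} \<and>
     (\<forall>i\<in>{1..n}. distr M (count_space UNIV) (X i) = measure_pmf p)"

definition sample_multiplicity :: "nat \<Rightarrow> (nat \<Rightarrow> nat) \<Rightarrow> nat \<Rightarrow> nat" where
  "sample_multiplicity n x i = (\<Sum>k=1..n. if x k = x i then 1 else 0)"

text \<open>For \<open>1 \<le> i \<le> n\<close> both natural-number subtractions below are exact, since the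
  multiplicity of the \<open>i\<close>-th sample point is at least 1.\<close>
definition harmonic_entropy_estimator :: "nat \<Rightarrow> (nat \<Rightarrow> nat) \<Rightarrow> real" where
  "harmonic_entropy_estimator n x =
     (1 / real n) * (\<Sum>i=1..n. harm (n - 1) - harm (sample_multiplicity n x i - 1))"

end

theory Submission
  imports Defs
begin

text \<open>
  The mean squared error is variance plus squared bias. Conditionally on \<open>X i = j\<close>, the multiplicity
  minus one is binomial with parameters \<open>n - 1\<close> and \<open>p j\<close>, and for such a variable \<open>B\<close> one has
  \<open>E (harm N - harm B) = (\<Sum>k=1..N. (1 - q) ^ k / k)\<close>, a partial sum of the series of \<open>- ln q\<close>.
  The bias is therefore the \<open>p\<close>-average of the remainders of this series. The remainder is at most
  \<open>1 / (n q)\<close> and at most a constant times \<open>(n q) powr (- d)\<close>; using the first bound for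
  \<open>j \<le> n powr \<alpha>\<close> and the second beyond gives the rate \<open>n powr (\<alpha> - 1)\<close>.

  For the variance, the Efron--Stein inequality allows \<open>n\<close> times the estimator to be compared, for
  each \<open>i\<close>, with any function not depending on the \<open>i\<close>-th observation. Deleting that observation
  and shifting by \<open>harm (n - 1) + 1\<close> changes the sum by at most \<open>1 + harm (n - 1) - harm B\<close>, whose
  second moment stays bounded in \<open>n\<close> because \<open>p powr (1 - d)\<close> is summable for small \<open>d > 0\<close>.

  Since the rate is never better than \<open>1 / n\<close>, the case \<open>\<alpha> = 0\<close> follows from \<open>\<alpha> = 1 / 2\<close>.
\<close>

subsection \<open>Expectations under product distributions\<close>

lemma integrable_pmf_bounded:
  fixes f :: "'a \<Rightarrow> real"
  assumes "\<And>x. \<bar>f x\<bar> \<le> B"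
  shows "integrable (measure_pmf p) f"
  using assms by (intro measure_pmf.integrable_const_bound[where B = B]) auto

lemma expectation_pmf_mono:
  fixes f g :: "'a \<Rightarrow> real"
  assumes "\<And>x. \<bar>f x\<bar> \<le> B" "\<And>x. \<bar>g x\<bar> \<le> C" "\<And>x. f x \<le> g x"
  shows "measure_pmf.expectation p f \<le> measure_pmf.expectation p g"
  by (intro integral_mono integrable_pmf_bounded[of _ B] integrable_pmf_bounded[of _ C] assms)

lemma abs_expectation_pmf_le:
  fixes f :: "'a \<Rightarrow> real"
  assumes "\<And>x. \<bar>f x\<bar> \<le> B"
  shows "\<bar>measure_pmf.expectation p f\<bar> \<le> B"
proof -
  have "\<bar>measure_pmf.expectation p f\<bar> \<le> measure_pmf.expectation p (\<lambda>x. \<bar>f x\<bar>)"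
    using integral_norm_bound[of "measure_pmf p" f] by simp
  also have "\<dots> \<le> measure_pmf.expectation p (\<lambda>_. B)"
    by (rule expectation_pmf_mono[where B = B and C = "\<bar>B\<bar>"]) (use assms in auto)
  finally show ?thesis by simp
qed

lemma expectation_bind_pmf_bounded:
  fixes f :: "'b \<Rightarrow> real"
  assumes "\<And>x. \<bar>f x\<bar> \<le> B"
  shows "measure_pmf.expectation (bind_pmf p q) f =
    measure_pmf.expectation p (\<lambda>x. measure_pmf.expectation (q x) f)"
  unfolding measure_pmf_bind
  by (rule integral_bind[where K = "count_space UNIV" and B = B and B' = 1])
    (use assms measurable_measure_pmf[of q] in \<open>auto simp: measure_pmf.emeasure_eq_measure\<close>)

text \<open>Coordinate \<open>i\<close> is independent of the others, so it may be averaged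
  innermost or outermost. The first order serves the induction in \<open>efron_stein_Pi_pmf\<close>;
  the second conditions on one observation in
  \<open>expectation_leave_one_out_count\<close>.\<close>

lemma expectation_Pi_pmf_insert:
  fixes f :: "('i \<Rightarrow> 'b) \<Rightarrow> real"
  assumes "finite A" "i \<notin> A" "\<And>x. \<bar>f x\<bar> \<le> B"
  shows "measure_pmf.expectation (Pi_pmf (insert i A) d p) f =
    measure_pmf.expectation (Pi_pmf A d p) (\<lambda>x. measure_pmf.expectation (p i) (\<lambda>y. f (x(i := y))))"
    and "measure_pmf.expectation (Pi_pmf (insert i A) d p) f =
    measure_pmf.expectation (p i) (\<lambda>y. measure_pmf.expectation (Pi_pmf A d p) (\<lambda>x. f (x(i := y))))"
proof -
  have "Pi_pmf (insert i A) d p =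
      bind_pmf (Pi_pmf A d p) (\<lambda>x. map_pmf (\<lambda>y. x(i := y)) (p i))"
    using assms(1,2)
    by (subst Pi_pmf_insert') (simp_all add: map_pmf_def bind_commute_pmf[of "p i"])
  thus "measure_pmf.expectation (Pi_pmf (insert i A) d p) f =
    measure_pmf.expectation (Pi_pmf A d p) (\<lambda>x. measure_pmf.expectation (p i) (\<lambda>y. f (x(i := y))))"
    by (simp add: expectation_bind_pmf_bounded[OF assms(3)])
  have "Pi_pmf (insert i A) d p =
      bind_pmf (p i) (\<lambda>y. map_pmf (\<lambda>x. x(i := y)) (Pi_pmf A d p))"
    using assms(1,2) by (subst Pi_pmf_insert') (simp_all add: map_pmf_def)
  thus "measure_pmf.expectation (Pi_pmf (insert i A) d p) f =
    measure_pmf.expectation (p i) (\<lambda>y. measure_pmf.expectation (Pi_pmf A d p) (\<lambda>x. f (x(i := y))))"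
    by (simp add: expectation_bind_pmf_bounded[OF assms(3)])
qed

text \<open>Bias-variance decomposition. Besides splitting the mean squared error, it shows that the
  mean is the best constant predictor, and \<open>c = 0\<close> gives Jensen's inequality for the
  square.\<close>

lemma expectation_square_pmf:
  fixes f :: "'a \<Rightarrow> real"
  assumes "\<And>x. \<bar>f x\<bar> \<le> B"
  shows "measure_pmf.expectation p (\<lambda>x. (f x - c)\<^sup>2) =
    measure_pmf.expectation p (\<lambda>x. (f x - measure_pmf.expectation p f)\<^sup>2)
      + (measure_pmf.expectation p f - c)\<^sup>2"
proof -
  have f: "integrable (measure_pmf p) f" by (rule integrable_pmf_bounded[OF assms])
  have "\<bar>(f x)\<^sup>2\<bar> \<le> B\<^sup>2" for x
    using power_mono[OF assms[of x], of 2] by simp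
  hence f2: "integrable (measure_pmf p) (\<lambda>x. (f x)\<^sup>2)" by (rule integrable_pmf_bounded)
  have *: "measure_pmf.expectation p (\<lambda>x. (f x - a)\<^sup>2) =
     measure_pmf.expectation p (\<lambda>x. (f x)\<^sup>2) - 2 * measure_pmf.expectation p f * a + a\<^sup>2" for a
    using f f2 by (simp add: power2_diff)
  show ?thesis unfolding * by (simp add: power2_eq_square algebra_simps)
qed

lemma variance_pmf_le:
  fixes f :: "'a \<Rightarrow> real"
  assumes "\<And>x. \<bar>f x\<bar> \<le> B"
  shows "measure_pmf.expectation p (\<lambda>x. (f x - measure_pmf.expectation p f)\<^sup>2)
    \<le> measure_pmf.expectation p (\<lambda>x. (f x - c)\<^sup>2)"
  using expectation_square_pmf[OF assms, where p = p and c = c] by simp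

lemma square_expectation_pmf_le:
  fixes f :: "'a \<Rightarrow> real"
  assumes "\<And>x. \<bar>f x\<bar> \<le> B"
  shows "(measure_pmf.expectation p f)\<^sup>2 \<le> measure_pmf.expectation p (\<lambda>x. (f x)\<^sup>2)"
  using expectation_square_pmf[OF assms, where p = p and c = 0] by simp

text \<open>Induction over the coordinates by the law of total variance. Averaging out coordinate
  \<open>i\<close> leaves an inner variance, at most the mean squared distance to
  \<open>g i\<close>, which is constant in that coordinate, and the variance of the average
  \<open>F\<close>, to which the induction hypothesis applies.\<close>

theorem efron_stein_Pi_pmf:
  fixes f :: "('i \<Rightarrow> 'b) \<Rightarrow> real" and g :: "'i \<Rightarrow> ('i \<Rightarrow> 'b) \<Rightarrow> real"
  assumes "finite A" "\<And>x. \<bar>f x\<bar> \<le> B" "\<And>i x. i \<in> A \<Longrightarrow> \<bar>g i x\<bar> \<le> B"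
    and "\<And>i x y. i \<in> A \<Longrightarrow> g i (x(i := y)) = g i x"
  shows "measure_pmf.expectation (Pi_pmf A d p)
      (\<lambda>x. (f x - measure_pmf.expectation (Pi_pmf A d p) f)\<^sup>2)
    \<le> (\<Sum>i\<in>A. measure_pmf.expectation (Pi_pmf A d p) (\<lambda>x. (f x - g i x)\<^sup>2))"
  using assms
proof (induction A arbitrary: f g rule: finite_induct)
  case empty
  thus ?case by simp
next
  case (insert i A)
  let ?P = "Pi_pmf A d p" and ?Q = "Pi_pmf (insert i A) d p"
  define F where "F x = measure_pmf.expectation (p i) (\<lambda>y. f (x(i := y)))" for x
  \<comment> \<open>The comparison functions are averaged along with \<open>f\<close>;
    \<open>G k\<close> still ignores coordinate \<open>k\<close> and so is admissible in the
    induction hypothesis.\<close>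
  define G where "G k x = measure_pmf.expectation (p i) (\<lambda>y. g k (x(i := y)))" for k x
  have fb: "\<bar>f x\<bar> \<le> B" for x by fact
  have gb: "\<bar>g k x\<bar> \<le> B" if "k \<in> insert i A" for k x using insert that by blast
  have Fb: "\<bar>F x\<bar> \<le> B" for x unfolding F_def by (rule abs_expectation_pmf_le) (rule fb)
  have Gb: "\<bar>G k x\<bar> \<le> B" if "k \<in> A" for k x
    unfolding G_def by (rule abs_expectation_pmf_le) (rule gb, use that in auto)
  have sq: "\<bar>(u - v)\<^sup>2\<bar> \<le> (2 * B)\<^sup>2" if "\<bar>u\<bar> \<le> B" "\<bar>v\<bar> \<le> B" for u v :: real
    using power_mono[of "\<bar>u - v\<bar>" "2 * B" 2] that by simp
  define m where "m = measure_pmf.expectation ?Q f"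
  have mb: "\<bar>m\<bar> \<le> B" unfolding m_def by (rule abs_expectation_pmf_le) (rule fb)
  have m: "m = measure_pmf.expectation ?P F"
    unfolding m_def F_def by (rule expectation_Pi_pmf_insert[OF insert(1,2) fb])
  have gi: "g i (x(i := y)) = g i x" for x y using insert by blast
  have "measure_pmf.expectation ?Q (\<lambda>x. (f x - m)\<^sup>2) =
      measure_pmf.expectation ?P (\<lambda>x. measure_pmf.expectation (p i) (\<lambda>y. (f (x(i := y)) - m)\<^sup>2))"
    by (rule expectation_Pi_pmf_insert(1)[OF insert(1,2) sq[OF fb mb]])
  \<comment> \<open>With the other coordinates fixed, the decomposition is taken around the
    conditional mean \<open>F x\<close>.\<close>
  also have "\<dots> = measure_pmf.expectation ?P (\<lambda>x.
      measure_pmf.expectation (p i) (\<lambda>y. (f (x(i := y)) - F x)\<^sup>2) + (F x - m)\<^sup>2)"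
    unfolding F_def by (subst expectation_square_pmf[OF fb]) simp
  \<comment> \<open>As a function of \<open>y\<close>, \<open>g i (x(i := y))\<close> is constant,
    hence a competitor to the mean \<open>F x\<close>.\<close>
  also have "\<dots> \<le> measure_pmf.expectation ?P (\<lambda>x.
      measure_pmf.expectation (p i) (\<lambda>y. (f (x(i := y)) - g i (x(i := y)))\<^sup>2) + (F x - m)\<^sup>2)"
  proof (rule expectation_pmf_mono[where B = "(2*B)\<^sup>2 + (2*B)\<^sup>2" and C = "(2*B)\<^sup>2 + (2*B)\<^sup>2"])
    fix x
    show "\<bar>measure_pmf.expectation (p i) (\<lambda>y. (f (x(i := y)) - F x)\<^sup>2) + (F x - m)\<^sup>2\<bar>
        \<le> (2 * B)\<^sup>2 + (2 * B)\<^sup>2"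
      by (intro abs_triangle_ineq[THEN order_trans] add_mono abs_expectation_pmf_le sq fb Fb mb)
    show "\<bar>measure_pmf.expectation (p i) (\<lambda>y. (f (x(i := y)) - g i (x(i := y)))\<^sup>2) + (F x - m)\<^sup>2\<bar>
        \<le> (2 * B)\<^sup>2 + (2 * B)\<^sup>2"
      by (intro abs_triangle_ineq[THEN order_trans] add_mono abs_expectation_pmf_le sq fb Fb mb gb) simp
    show "measure_pmf.expectation (p i) (\<lambda>y. (f (x(i := y)) - F x)\<^sup>2) + (F x - m)\<^sup>2
      \<le> measure_pmf.expectation (p i) (\<lambda>y. (f (x(i := y)) - g i (x(i := y)))\<^sup>2) + (F x - m)\<^sup>2"
      unfolding F_def gi by (intro add_mono variance_pmf_le[OF fb]) simp
  qed
  also have "\<dots> = measure_pmf.expectation ?P (\<lambda>x.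
      measure_pmf.expectation (p i) (\<lambda>y. (f (x(i := y)) - g i (x(i := y)))\<^sup>2))
    + measure_pmf.expectation ?P (\<lambda>x. (F x - m)\<^sup>2)"
    by (intro Bochner_Integration.integral_add integrable_pmf_bounded[where B = "(2*B)\<^sup>2"]
        abs_expectation_pmf_le sq fb gb Fb mb) simp
  also have "measure_pmf.expectation ?P (\<lambda>x.
      measure_pmf.expectation (p i) (\<lambda>y. (f (x(i := y)) - g i (x(i := y)))\<^sup>2)) =
     measure_pmf.expectation ?Q (\<lambda>x. (f x - g i x)\<^sup>2)"
    by (rule expectation_Pi_pmf_insert(1)[OF insert(1,2) sq[OF fb gb], symmetric]) simp
  also have "measure_pmf.expectation ?P (\<lambda>x. (F x - m)\<^sup>2)
      \<le> (\<Sum>k\<in>A. measure_pmf.expectation ?P (\<lambda>x. (F x - G k x)\<^sup>2))"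
    unfolding m
  proof (rule insert.IH)
    fix k and x :: "'i \<Rightarrow> 'b" and y assume k: "k \<in> A"
    have "x(k := y, i := z) = x(i := z, k := y)" for z
      using insert(2) k by (intro fun_upd_twist) auto
    moreover have "g k (z(k := y)) = g k z" for z using insert k by blast
    ultimately show "G k (x(k := y)) = G k x" unfolding G_def by simp
  qed (use Fb Gb in auto)
  also have "\<dots> \<le> (\<Sum>k\<in>A. measure_pmf.expectation ?Q (\<lambda>x. (f x - g k x)\<^sup>2))"
  proof (rule sum_mono)
    fix k assume k: "k \<in> A"
    have k': "k \<in> insert i A" using k by simp
    have d: "\<bar>u - v\<bar> \<le> 2 * B" if "\<bar>u\<bar> \<le> B" "\<bar>v\<bar> \<le> B" for u v :: real
      using that by linarith
    have FG: "F x - G k x = measure_pmf.expectation (p i) (\<lambda>y. f (x(i := y)) - g k (x(i := y)))" for x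
      unfolding F_def G_def
      by (intro Bochner_Integration.integral_diff[symmetric] integrable_pmf_bounded[of _ B] fb gb[OF k'])
    \<comment> \<open>Jensen's inequality in coordinate \<open>i\<close>: the squared average is at
      most the average square, after which the two averages recombine into one over
      \<open>?Q\<close>.\<close>
    have "measure_pmf.expectation ?P (\<lambda>x. (F x - G k x)\<^sup>2) \<le> measure_pmf.expectation ?P (\<lambda>x.
      measure_pmf.expectation (p i) (\<lambda>y. (f (x(i := y)) - g k (x(i := y)))\<^sup>2))"
      by (rule expectation_pmf_mono[OF sq[OF Fb Gb[OF k]] abs_expectation_pmf_le[OF sq[OF fb gb[OF k']]]])
        (unfold FG, rule square_expectation_pmf_le[OF d[OF fb gb[OF k']]])
    also have "\<dots> = measure_pmf.expectation ?Q (\<lambda>x. (f x - g k x)\<^sup>2)"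
      by (rule expectation_Pi_pmf_insert(1)[OF insert(1,2) sq[OF fb gb[OF k']], symmetric])
    finally show "measure_pmf.expectation ?P (\<lambda>x. (F x - G k x)\<^sup>2)
      \<le> measure_pmf.expectation ?Q (\<lambda>x. (f x - g k x)\<^sup>2)" .
  qed
  finally show ?case using insert(1,2) by (simp add: m_def)
qed

lemma expectation_pmf_nat:
  fixes p :: "nat pmf" and h :: "nat \<Rightarrow> real"
  assumes "summable (\<lambda>j. \<bar>pmf p j * h j\<bar>)"
  shows "integrable (measure_pmf p) h"
    and "measure_pmf.expectation p h = (\<Sum>j. pmf p j * h j)"
proof -
  have *: "integrable (count_space UNIV) (\<lambda>j. pmf p j * h j)"
    using assms by (simp add: integrable_count_space_nat_iff)
  thus "integrable (measure_pmf p) h"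
    by (simp add: measure_pmf_eq_density integrable_density)
  show "measure_pmf.expectation p h = (\<Sum>j. pmf p j * h j)"
    using integral_count_space_nat[OF *] by (simp add: measure_pmf_eq_density integral_density)
qed

subsection \<open>Harmonic numbers of binomial variables\<close>

lemma map_pmf_eq_bernoulli:
  "map_pmf (\<lambda>y. y = j) p = bernoulli_pmf (pmf p j)"
proof (rule pmf_eqI)
  fix b
  have 1: "pmf (map_pmf (\<lambda>y. y = j) p) True = pmf p j"
    by (simp add: pmf_map vimage_def measure_pmf_single)
  have "pmf (map_pmf (\<lambda>y. y = j) p) False = measure_pmf.prob p (space (measure_pmf p) - {j})"
    by (simp add: pmf_map vimage_def set_diff_eq)
  also have "\<dots> = 1 - pmf p j"
    by (subst measure_pmf.prob_compl) (auto simp: measure_pmf_single)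
  finally show "pmf (map_pmf (\<lambda>y. y = j) p) b = pmf (bernoulli_pmf (pmf p j)) b"
    using 1 by (cases b) (simp_all add: pmf_le_1)
qed

lemma count_Pi_pmf_binomial:
  assumes "finite A"
  shows "map_pmf (\<lambda>x. card {k\<in>A. x k = j}) (Pi_pmf A d (\<lambda>_. p)) = binomial_pmf (card A) (pmf p j)"
proof -
  \<comment> \<open>The default \<open>d = j\<close> is the image of the default \<open>d\<close>
    under the indicator of \<open>j\<close>, as \<open>Pi_pmf_map\<close> demands.\<close>
  have "binomial_pmf (card A) (pmf p j) =
      map_pmf (\<lambda>f. card {k\<in>A. f k}) (Pi_pmf A (d = j) (\<lambda>_. map_pmf (\<lambda>y. y = j) p))"
    unfolding map_pmf_eq_bernoulli
    by (rule binomial_pmf_altdef') (use assms pmf_le_1 in auto)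
  also have "\<dots> = map_pmf (\<lambda>x. card {k\<in>A. x k = j}) (Pi_pmf A d (\<lambda>_. p))"
    by (subst Pi_pmf_map[OF assms refl]) (simp add: pmf.map_comp o_def)
  finally show ?thesis ..
qed

lemma expectation_binomial_pmf_Suc:
  fixes f :: "nat \<Rightarrow> real"
  assumes q: "q \<in> {0..1}"
  shows "measure_pmf.expectation (binomial_pmf (Suc N) q) f =
    q * measure_pmf.expectation (binomial_pmf N q) (\<lambda>b. f (Suc b))
    + (1 - q) * measure_pmf.expectation (binomial_pmf N q) f"
proof -
  have "measure_pmf.expectation (binomial_pmf (Suc N) q) f =
    measure_pmf.expectation (bernoulli_pmf q \<bind>
      (\<lambda>b. map_pmf (\<lambda>k. (if b then 1 else 0) + k) (binomial_pmf N q))) f"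
    by (simp add: binomial_pmf_Suc[OF q] map_pmf_def)
  also have "\<dots> = (\<Sum>b\<in>UNIV. pmf (bernoulli_pmf q) b *\<^sub>R
      measure_pmf.expectation (map_pmf (\<lambda>k. (if b then 1 else 0) + k) (binomial_pmf N q)) f)"
    by (rule pmf_expectation_bind)
      (use finite_set_pmf_binomial_pmf[OF q] in \<open>auto intro: finite_imageI\<close>)
  finally show ?thesis using q by (simp add: UNIV_bool)
qed

text \<open>By absorption, \<open>Suc k * (Suc N choose Suc k) = Suc N * (N choose k)\<close>, so
  dividing by \<open>Suc k\<close> turns the weights for \<open>N\<close> trials into those for
  \<open>Suc N\<close> trials, shifted by one. These sum to 1 minus the weight of zero
  successes.\<close>

lemma expectation_binomial_inverse_Suc:
  assumes q: "q \<in> {0<..1}"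
  shows "measure_pmf.expectation (binomial_pmf N q) (\<lambda>b. 1 / real (Suc b)) =
    (1 - (1 - q) ^ Suc N) / (real (Suc N) * q)"
proof -
  have "(q + (1 - q)) ^ Suc N =
      (\<Sum>k\<le>Suc N. real (Suc N choose k) * q ^ k * (1 - q) ^ (Suc N - k))"
    by (rule binomial_ring)
  also have "\<dots> = (1 - q) ^ Suc N +
      (\<Sum>k\<le>N. real (Suc N choose Suc k) * q ^ Suc k * (1 - q) ^ (N - k))"
    by (subst sum.atMost_Suc_shift) simp
  also have "(\<Sum>k\<le>N. real (Suc N choose Suc k) * q ^ Suc k * (1 - q) ^ (N - k)) =
     (\<Sum>k\<le>N. real (Suc N) * q * ((real (N choose k) * q ^ k * (1 - q) ^ (N - k)) * (1 / real (Suc k))))"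
  proof (rule sum.cong[OF refl])
    fix k
    have "real (Suc k) * real (Suc N choose Suc k) = real (Suc N) * real (N choose k)"
      by (metis Suc_times_binomial of_nat_mult)
    hence "real (Suc N choose Suc k) = real (Suc N) * real (N choose k) / real (Suc k)"
      by (simp add: field_simps del: binomial_Suc_Suc)
    thus "real (Suc N choose Suc k) * q ^ Suc k * (1 - q) ^ (N - k) =
      real (Suc N) * q * ((real (N choose k) * q ^ k * (1 - q) ^ (N - k)) * (1 / real (Suc k)))"
      by (simp del: binomial_Suc_Suc)
  qed
  also have "\<dots> = real (Suc N) * q * measure_pmf.expectation (binomial_pmf N q) (\<lambda>b. 1 / real (Suc b))"
    using q by (subst expectation_binomial_pmf') (simp_all add: sum_distrib_left)
  finally have "real (Suc N) * q * measure_pmf.expectation (binomial_pmf N q) (\<lambda>b. 1 / real (Suc b))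
    = 1 - (1 - q) ^ Suc N" by simp
  thus ?thesis using q by (subst nonzero_eq_divide_eq) (simp_all only: mult.commute, auto)
qed

text \<open>Conditioning on one extra trial raises the mean of \<open>harm\<close> by
  \<open>q\<close> times the mean of \<open>1 / Suc b\<close>, that is by
  \<open>(1 - (1 - q) ^ Suc N) / Suc N\<close>. Its two parts are the new terms of
  \<open>harm\<close> and of the sum.\<close>

lemma expectation_binomial_harm:
  assumes q: "q \<in> {0<..1}"
  shows "measure_pmf.expectation (binomial_pmf N q) (\<lambda>b. harm b :: real) =
    harm N - (\<Sum>k=1..N. (1 - q) ^ k / real k)"
proof (induction N)
  case 0
  thus ?case using q by (subst expectation_binomial_pmf') (auto simp: harm_def)
next
  case (Suc N)
  let ?E = "measure_pmf.expectation (binomial_pmf N q)"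
  have q': "q \<in> {0..1}" using q by auto
  have "?E (\<lambda>b. harm (Suc b)) = ?E (\<lambda>b. harm b + 1 / real (Suc b))"
    by (simp add: harm_Suc inverse_eq_divide)
  also have "\<dots> = ?E (\<lambda>b. harm b) + ?E (\<lambda>b. 1 / real (Suc b))"
    using q' by (intro Bochner_Integration.integral_add) auto
  finally have "measure_pmf.expectation (binomial_pmf (Suc N) q) (\<lambda>b. harm b :: real) =
     ?E (\<lambda>b. harm b) + q * ?E (\<lambda>b. 1 / real (Suc b))"
    unfolding expectation_binomial_pmf_Suc[OF q'] by (simp add: algebra_simps)
  also have "q * ?E (\<lambda>b. 1 / real (Suc b)) = (1 - (1 - q) ^ Suc N) / real (Suc N)"
    unfolding expectation_binomial_inverse_Suc[OF q] using q by simp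
  finally show ?case
    by (simp add: Suc harm_Suc inverse_eq_divide diff_divide_distrib)
qed

lemma harm_diff_le_ln:
  assumes "b \<le> N"
  shows "harm N - harm b \<le> 2 * ln (real (Suc N) / real (Suc b))"
  using assms
proof (induction N rule: dec_induct)
  case (step N)
  \<comment> \<open>The factor 2 pays for replacing \<open>1 / (N + 1)\<close> by
    \<open>1 / (N + 2)\<close>, which lies below the increment of the logarithm.\<close>
  have "1 / real (Suc N) \<le> 2 * (1 / real (Suc (Suc N)))" by (simp add: field_simps)
  also have "1 / real (Suc (Suc N)) \<le> ln (real (Suc (Suc N)) / real (Suc N))"
    using ln_le_minus_one[of "real (Suc N) / real (Suc (Suc N))"]
    by (simp add: ln_div field_simps)
  finally have "1 / real (Suc N) \<le> 2 * ln (real (Suc (Suc N)) / real (Suc N))" by simp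
  thus ?case using step.IH by (simp add: harm_Suc inverse_eq_divide ln_div)
qed simp

text \<open>The logarithm is traded for a power with exponent \<open>d / 2\<close>, which squaring
  doubles. The constant is \<open>1 / d\<close> for the summand 1 plus \<open>4 / d\<close> for
  twice the logarithm.\<close>

lemma square_harm_diff_le_powr:
  assumes "b \<le> N" "0 < d" "d \<le> 1"
  shows "(1 + (harm N - harm b))\<^sup>2 \<le> (5 / d)\<^sup>2 * (real (Suc N) / real (Suc b)) powr d"
proof -
  define y where "y = real (Suc N) / real (Suc b)"
  have y: "y \<ge> 1" using assms(1) by (simp add: y_def)
  have "ln y \<le> y powr (d/2) / (d/2)" using y assms by (intro ln_powr_bound) auto
  moreover have "1 \<le> y powr (d/2) / d"
    using ge_one_powr_ge_zero[of y "d/2"] y assms by (simp add: field_simps)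
  moreover have "harm N - harm b \<le> 2 * ln y" unfolding y_def by (rule harm_diff_le_ln[OF assms(1)])
  ultimately have "1 + (harm N - harm b) \<le> 5 / d * y powr (d/2)" by (simp add: field_simps)
  moreover have "0 \<le> harm N - (harm b :: real)" using harm_mono[OF assms(1)] by simp
  ultimately have "(1 + (harm N - harm b))\<^sup>2 \<le> (5 / d * y powr (d/2))\<^sup>2"
    by (intro power_mono) auto
  also have "\<dots> = (5/d)\<^sup>2 * y powr d"
    by (simp add: power_mult_distrib power2_eq_square flip: powr_add)
  finally show ?thesis by (simp add: y_def)
qed

text \<open>Splitting \<open>y powr d\<close> at the threshold \<open>t = 1 / q\<close> replaces an appeal to Jensen's inequality.\<close>
lemma expectation_binomial_square_harm_diff:
  assumes q: "q \<in> {0<..1}" and d: "0 < d" "d \<le> 1"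
  shows "measure_pmf.expectation (binomial_pmf N q) (\<lambda>b. (1 + (harm N - harm b))\<^sup>2)
    \<le> 2 * (5 / d)\<^sup>2 * q powr (- d)"
proof -
  let ?E = "measure_pmf.expectation (binomial_pmf N q)"
  have q': "q \<in> {0..1}" using q by auto
  have *: "y powr d \<le> q powr (- d) + q powr (1 - d) * y" if "y > 0" for y :: real
  proof (cases "y \<le> 1 / q")
    case True
    hence "y powr d \<le> (1 / q) powr d" using d that by (intro powr_mono2) auto
    also have "\<dots> = q powr (- d)" using q by (simp add: powr_minus powr_divide field_simps)
    finally show ?thesis using that by (simp add: add_increasing2)
  next
    case False
    hence "1 \<le> y * q" using q by (simp add: field_simps)
    hence "1 \<le> (y * q) powr (1 - d)" using d by (intro ge_one_powr_ge_zero) auto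
    hence "y powr d * 1 \<le> y powr d * (y * q) powr (1 - d)" by (intro mult_left_mono) auto
    also have "\<dots> = (y powr d * y powr (1 - d)) * q powr (1 - d)"
      using that q by (simp add: powr_mult)
    also have "y powr d * y powr (1 - d) = y"
      using that by (simp flip: powr_add)
    finally show ?thesis by (simp add: add_increasing mult.commute)
  qed
  \<comment> \<open>The majorant is affine in \<open>1 / Suc b\<close>, whose mean is known exactly.
    The comparison holds only for \<open>b \<le> N\<close>, hence almost everywhere.\<close>
  have "?E (\<lambda>b. (1 + (harm N - harm b))\<^sup>2) \<le>
     ?E (\<lambda>b. (5/d)\<^sup>2 * (q powr (- d) + q powr (1 - d) * (real (Suc N) * (1 / real (Suc b)))))"
  proof (rule integral_mono_AE)
    show "AE b in binomial_pmf N q. (1 + (harm N - harm b))\<^sup>2 \<le>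
      (5/d)\<^sup>2 * (q powr (- d) + q powr (1 - d) * (real (Suc N) * (1 / real (Suc b))))"
    proof (rule AE_pmfI)
      fix b assume "b \<in> set_pmf (binomial_pmf N q)"
      hence "b \<le> N" using q' by (auto simp: set_pmf_binomial_eq split: if_splits)
      hence "(1 + (harm N - harm b))\<^sup>2 \<le> (5 / d)\<^sup>2 * (real (Suc N) / real (Suc b)) powr d"
        using d by (intro square_harm_diff_le_powr)
      also have "\<dots> \<le> (5/d)\<^sup>2 * (q powr (- d) + q powr (1 - d) * (real (Suc N) / real (Suc b)))"
        by (intro mult_left_mono *) auto
      finally show "(1 + (harm N - harm b))\<^sup>2 \<le>
        (5/d)\<^sup>2 * (q powr (- d) + q powr (1 - d) * (real (Suc N) * (1 / real (Suc b))))" by simp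
    qed
  qed (use q' in auto)
  also have "\<dots> = (5/d)\<^sup>2 * (q powr (- d) + q powr (1 - d) * (real (Suc N) * ?E (\<lambda>b. 1 / real (Suc b))))"
  proof -
    have "?E (\<lambda>b. c * (u + v * (w * g b))) = c * (u + v * (w * ?E g))" for c u v w and g :: "nat \<Rightarrow> real"
      using q' by simp
    thus ?thesis .
  qed
  also have "real (Suc N) * ?E (\<lambda>b. 1 / real (Suc b)) \<le> 1 / q"
  proof -
    have "real (Suc N) * ?E (\<lambda>b. 1 / real (Suc b)) = (1 - (1 - q) ^ Suc N) / q"
      unfolding expectation_binomial_inverse_Suc[OF q] by (simp del: power_Suc of_nat_Suc)
    also have "\<dots> \<le> 1 / q" using q by (intro divide_right_mono) auto
    finally show ?thesis .
  qed
  also have "q powr (1 - d) * (1 / q) = q powr (- d)"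
    using q by (simp add: powr_diff powr_minus field_simps)
  finally show ?thesis by (simp add: mult_left_mono)
qed

subsection \<open>The series of the logarithm\<close>

text \<open>Comparison of a sum with an integral, by the mean value theorem; the right side
  telescopes when summed over \<open>x\<close>.\<close>

lemma powr_neg_le_telescope:
  fixes x s :: real
  assumes "x > 0" "s > 1"
  shows "(x + 1) powr (- s) \<le> (x powr (1 - s) - (x + 1) powr (1 - s)) / (s - 1)"
proof -
  have "\<exists>z>x. z < x + 1 \<and> (x + 1) powr (1 - s) - x powr (1 - s) = (x + 1 - x) * ((1 - s) * z powr (1 - s - 1))"
  proof (rule MVT2)
    fix z assume "x \<le> z"
    thus "((\<lambda>z. z powr (1 - s)) has_real_derivative (1 - s) * z powr (1 - s - 1)) (at z)"
      using assms by (intro has_real_derivative_powr) auto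
  qed simp
  then obtain z where z: "z > x" "z < x + 1"
    "(x + 1) powr (1 - s) - x powr (1 - s) = (1 - s) * z powr (- s)" by auto
  have "(x + 1) powr (- s) \<le> z powr (- s)" using z assms by (intro powr_mono2') auto
  hence "(s - 1) * (x + 1) powr (- s) \<le> (s - 1) * z powr (- s)"
    using assms by (intro mult_left_mono) auto
  also have "\<dots> = x powr (1 - s) - (x + 1) powr (1 - s)" using z(3) by (simp add: algebra_simps)
  finally show ?thesis using assms by (simp add: field_simps)
qed

lemma powr_tail_series:
  fixes s :: real
  assumes "s > 1" "J > 0"
  shows "summable (\<lambda>j. real (j + Suc J) powr (- s))"
    and "(\<Sum>j. real (j + Suc J) powr (- s)) \<le> real J powr (1 - s) / (s - 1)"
proof -
  \<comment> \<open>The subtracted term lets the induction telescope; it is dropped in the bound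
    that follows.\<close>
  have *: "(\<Sum>j<m. real (j + Suc J) powr (- s)) \<le>
      (real J powr (1 - s) - real (J + m) powr (1 - s)) / (s - 1)" for m
  proof (induction m)
    case (Suc m)
    have "real (m + Suc J) powr (- s) \<le>
      (real (J + m) powr (1 - s) - real (J + Suc m) powr (1 - s)) / (s - 1)"
      using powr_neg_le_telescope[of "real (J + m)" s] assms by (simp add: algebra_simps)
    thus ?case using Suc.IH by (simp add: diff_divide_distrib)
  qed simp
  have **: "(\<Sum>j<m. real (j + Suc J) powr (- s)) \<le> real J powr (1 - s) / (s - 1)" for m
    by (rule order_trans[OF *]) (use assms in \<open>auto intro!: divide_right_mono\<close>)
  show "summable (\<lambda>j. real (j + Suc J) powr (- s))"
    by (rule summableI_nonneg_bounded[OF _ **]) simp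
  thus "(\<Sum>j. real (j + Suc J) powr (- s)) \<le> real J powr (1 - s) / (s - 1)"
    by (intro suminf_le_const **)
qed

text \<open>The gap is the tail from \<open>Suc N\<close> of the nonnegative series of
  \<open>- ln q\<close> in powers of \<open>1 - q\<close>. Lowering the denominators to
  \<open>Suc N\<close> and the exponents by \<open>Suc N\<close> leaves a geometric series with sum
  \<open>1 / q\<close>.\<close>

lemma neg_ln_gap_bounds:
  fixes q :: real
  assumes q: "0 < q" "q \<le> 1"
  shows "(\<Sum>k=1..N. (1 - q) ^ k / real k) \<le> - ln q"
    and "- ln q - (\<Sum>k=1..N. (1 - q) ^ k / real k) \<le> 1 / (real (Suc N) * q)"
proof -
  have "(\<lambda>k. - ((- (q - 1)) ^ k) / real k) sums ln (1 + (q - 1))"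
    by (rule ln_series') (use q in auto)
  hence "(\<lambda>k. (1 - q) ^ k / real k) sums (- ln q)"
    using sums_minus by force
  hence "(\<lambda>k. (1 - q) ^ (k + Suc N) / real (k + Suc N)) sums
      (- ln q - (\<Sum>k<Suc N. (1 - q) ^ k / real k))"
    by (rule sums_split_initial_segment)
  \<comment> \<open>The term at \<open>k = 0\<close> is a division by zero, with value 0.\<close>
  also have "(\<Sum>k<Suc N. (1 - q) ^ k / real k) = (\<Sum>k=1..N. (1 - q) ^ k / real k)"
    by (rule sum.mono_neutral_right) auto
  finally have S: "(\<lambda>k. (1 - q) ^ (k + Suc N) / real (k + Suc N)) sums
      (- ln q - (\<Sum>k=1..N. (1 - q) ^ k / real k))" .
  have "0 \<le> - ln q - (\<Sum>k=1..N. (1 - q) ^ k / real k)"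
    by (rule sums_le[OF _ sums_zero S]) (use q in auto)
  thus "(\<Sum>k=1..N. (1 - q) ^ k / real k) \<le> - ln q" by simp
  have "(\<lambda>k. (1 - q) ^ k / real (Suc N)) sums (1 / (1 - (1 - q)) / real (Suc N))"
    by (intro sums_divide geometric_sums) (use q in auto)
  hence T: "(\<lambda>k. (1 - q) ^ k / real (Suc N)) sums (1 / (real (Suc N) * q))"
    by (simp add: mult.commute)
  show "- ln q - (\<Sum>k=1..N. (1 - q) ^ k / real k) \<le> 1 / (real (Suc N) * q)"
  proof (rule sums_le[OF _ S T])
    fix k
    have "(1 - q) ^ (k + Suc N) \<le> (1 - q) ^ k" using q by (intro power_decreasing) auto
    thus "(1 - q) ^ (k + Suc N) / real (k + Suc N) \<le> (1 - q) ^ k / real (Suc N)"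
      using q by (intro frac_le) auto
  qed
qed

text \<open>Meant for small \<open>Suc N * q\<close>, where the bound by its reciprocal is too weak.
  Bernoulli's inequality gives the partial sum at least \<open>harm N - N * q\<close>, and
  \<open>harm N\<close> is at least \<open>ln (N + 1)\<close>.\<close>

lemma neg_ln_gap_le_ln:
  fixes q :: real
  assumes q: "0 < q" "q \<le> 1"
  shows "- ln q - (\<Sum>k=1..N. (1 - q) ^ k / real k) \<le> real (Suc N) * q - ln (real (Suc N) * q)"
proof -
  have "harm N - real N * q = (\<Sum>k=1..N. 1 / real k - q)"
    by (simp add: harm_def sum_subtractf inverse_eq_divide)
  also have "\<dots> \<le> (\<Sum>k=1..N. (1 - q) ^ k / real k)"
  proof (rule sum_mono)
    fix k assume k: "k \<in> {1..N}"
    have "1 + real k * (- q) \<le> (1 + (- q)) ^ k" using q by (intro Bernoulli_inequality) auto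
    hence "(1 - real k * q) / real k \<le> (1 - q) ^ k / real k" by (intro divide_right_mono) auto
    thus "1 / real k - q \<le> (1 - q) ^ k / real k" using k by (simp add: diff_divide_distrib)
  qed
  finally have "harm N - real N * q \<le> (\<Sum>k=1..N. (1 - q) ^ k / real k)" .
  moreover have "ln (real (Suc N) * q) = ln (real N + 1) + ln q"
    using q by (subst ln_mult) (auto simp: add.commute)
  moreover have "real (Suc N) * q = real N * q + q" by (simp add: algebra_simps)
  ultimately show ?thesis using ln_le_harm[of N] q by linarith
qed

text \<open>Interpolates the two bounds in \<open>y = Suc N * q\<close>: for
  \<open>y \<le> 1\<close> the logarithm is absorbed by \<open>y powr (- d)\<close>, and for
  \<open>y > 1\<close> already \<open>1 / y\<close> is smaller.\<close>

lemma neg_ln_gap_le_powr: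
  fixes q :: real
  assumes q: "0 < q" "q \<le> 1" and d: "0 < d" "d \<le> 1"
  shows "- ln q - (\<Sum>k=1..N. (1 - q) ^ k / real k) \<le> (1 + 1 / d) * (real (Suc N) * q) powr (- d)"
proof -
  define y where "y = real (Suc N) * q"
  have y: "y > 0" using q by (simp add: y_def)
  show ?thesis
  proof (cases "y \<le> 1")
    case True
    have "- ln y \<le> (1 / y) powr d / d"
      using ln_powr_bound[of "1 / y" d] True y d by (simp add: ln_div)
    moreover have "1 \<le> (1 / y) powr d" using True y d by (intro ge_one_powr_ge_zero) auto
    moreover have "(1 / y) powr d = y powr (- d)" using y by (simp add: powr_minus powr_divide field_simps)
    ultimately have "y - ln y \<le> (1 + 1 / d) * y powr (- d)" using True by (simp add: algebra_simps)
    thus ?thesis using neg_ln_gap_le_ln[OF q, of N] by (simp add: y_def)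
  next
    case False
    have "1 / y = y powr (- 1)" using y by (simp add: powr_minus field_simps)
    also have "\<dots> \<le> y powr (- d)" using False d by (intro powr_mono) auto
    also have "\<dots> \<le> (1 + 1 / d) * y powr (- d)" using d by (simp add: field_simps)
    finally show ?thesis using neg_ln_gap_bounds(2)[OF q, of N] by (simp add: y_def)
  qed
qed

section \<open>Sums under a power-law tail\<close>

lemma summable_powr_of_tail:
  fixes P :: "nat \<Rightarrow> real"
  assumes "\<And>j. 0 \<le> P j" "\<And>j. j \<ge> 1 \<Longrightarrow> P j \<le> C0 * real j powr (- 1 / \<alpha>)"
    and "0 < \<alpha>" "0 \<le> t" "t / \<alpha> > 1"
  shows "summable (\<lambda>j. P j powr t)"
    and "\<And>j. j \<ge> 1 \<Longrightarrow> P j powr t \<le> C0 powr t * real j powr (- (t / \<alpha>))"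
proof -
  have C0: "C0 \<ge> 0" using assms(1)[of 1] assms(2)[of 1] by simp
  show *: "P j powr t \<le> C0 powr t * real j powr (- (t / \<alpha>))" if "j \<ge> 1" for j
  proof -
    have "P j powr t \<le> (C0 * real j powr (- 1 / \<alpha>)) powr t"
      using assms that by (intro powr_mono2) auto
    also have "\<dots> = C0 powr t * real j powr (- (t / \<alpha>))"
      using C0 by (simp add: powr_mult powr_powr)
    finally show ?thesis .
  qed
  \<comment> \<open>The tail series with \<open>J = 1\<close> begins at index 2, hence the
    shift.\<close>
  have "summable (\<lambda>j. C0 powr t * real j powr (- (t / \<alpha>)))"
    using powr_tail_series(1)[of "t / \<alpha>" 1] assms
    by (intro summable_mult) (subst summable_iff_shift[of _ 2, symmetric], simp)
  thus "summable (\<lambda>j. P j powr t)"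
    by (rule summable_comparison_test') (use * in \<open>auto intro!: exI[of _ 1]\<close>)
qed

text \<open>A uniform bound on the head and a power bound on the tail. The head has
  \<open>Suc J\<close> terms because index 0, where the power bound is not assumed, belongs to
  it.\<close>

lemma suminf_le_initial_tail:
  fixes a :: "nat \<Rightarrow> real"
  assumes "s > 1" "J > 0" "\<And>j. 0 \<le> a j" "\<And>j. a j \<le> u" "\<And>j. j \<ge> 1 \<Longrightarrow> a j \<le> v * real j powr (- s)"
  shows "summable a" "suminf a \<le> real (Suc J) * u + v * (real J powr (1 - s) / (s - 1))"
proof -
  have v: "v \<ge> 0" using assms(3)[of 1] assms(5)[of 1] by simp
  have t: "summable (\<lambda>j. v * real (j + Suc J) powr (- s))"
    by (intro summable_mult powr_tail_series assms)
  have le: "a (j + Suc J) \<le> v * real (j + Suc J) powr (- s)" for j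
    by (rule assms(5)) simp
  have st: "summable (\<lambda>j. a (j + Suc J))"
    by (rule summable_comparison_test'[OF t, of 0]) (use assms(3) le in \<open>simp del: of_nat_Suc add_Suc_right\<close>)
  thus s: "summable a" by (subst (asm) summable_iff_shift)
  have "suminf a = (\<Sum>j. a (j + Suc J)) + (\<Sum>j<Suc J. a j)"
    by (rule suminf_split_initial_segment[OF s])
  also have "(\<Sum>j. a (j + Suc J)) \<le> (\<Sum>j. v * real (j + Suc J) powr (- s))"
    by (rule suminf_le[OF le st t])
  also have "\<dots> = v * (\<Sum>j. real (j + Suc J) powr (- s))"
    by (intro suminf_mult powr_tail_series assms)
  also have "\<dots> \<le> v * (real J powr (1 - s) / (s - 1))"
    by (intro mult_left_mono powr_tail_series assms v)
  also have "(\<Sum>j<Suc J. a j) \<le> (\<Sum>j<Suc J. u)" by (intro sum_mono assms)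
  finally show "suminf a \<le> real (Suc J) * u + v * (real J powr (1 - s) / (s - 1))" by simp
qed

text \<open>Each head term is at most \<open>P * (1 / (n * P)) = 1 / n\<close>, and there are about
  \<open>n powr \<alpha>\<close> of them. The tail terms are of order
  \<open>n powr (- d) * P powr (1 - d)\<close>, and their sum beyond the same threshold has the same
  order \<open>n powr (\<alpha> - 1)\<close>.\<close>

lemma neg_ln_gap_series_le:
  fixes P :: "nat \<Rightarrow> real"
  assumes P: "\<And>j. 0 \<le> P j" "\<And>j. P j \<le> 1" "\<And>j. j \<ge> 1 \<Longrightarrow> P j \<le> C0 * real j powr (- 1 / \<alpha>)"
    and \<alpha>: "0 < \<alpha>" "\<alpha> < 1"
  shows "\<exists>C. \<forall>N. (\<Sum>j. P j * (- ln (P j) - (\<Sum>k=1..N. (1 - P j) ^ k / real k)))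
    \<le> C * real (Suc N) powr (\<alpha> - 1)"
proof -
  \<comment> \<open>Any \<open>d\<close> strictly between 0 and \<open>1 - \<alpha>\<close> gives
    \<open>s > 1\<close>; the midpoint is taken.\<close>
  define d where "d = (1 - \<alpha>) / 2"
  define s where "s = (1 - d) / \<alpha>"
  define L where "L = C0 powr (1 - d)"
  have d: "0 < d" "d < 1" using \<alpha> by (auto simp: d_def)
  have s: "s > 1" using \<alpha> by (simp add: s_def d_def field_simps)
  have "(\<Sum>j. P j * (- ln (P j) - (\<Sum>k=1..N. (1 - P j) ^ k / real k)))
    \<le> (3 + (1 + 1 / d) * L / (s - 1)) * real (Suc N) powr (\<alpha> - 1)" for N
  proof -
    define n where "n = real (Suc N)"
    have n: "n \<ge> 1" by (simp add: n_def)
    define a where "a j = P j * (- ln (P j) - (\<Sum>k=1..N. (1 - P j) ^ k / real k))" for j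
    \<comment> \<open>The threshold where \<open>j powr (- 1 / \<alpha>)\<close> drops to about
      \<open>1 / n\<close>.\<close>
    define J where "J = nat \<lceil>n powr \<alpha>\<rceil>"
    have n\<alpha>: "n powr \<alpha> \<ge> 1" using n \<alpha> by (intro ge_one_powr_ge_zero) auto
    have J: "real J \<ge> n powr \<alpha>" "real J \<le> n powr \<alpha> + 1" using n\<alpha> by (auto simp: J_def)
    hence J0: "J > 0" using n\<alpha> by (cases J) auto
    have a0: "0 \<le> a j" for j
      using neg_ln_gap_bounds(1)[of "P j" N] P(1,2)[of j] by (cases "P j = 0") (auto simp: a_def)
    have a1: "a j \<le> 1 / n" for j
    proof (cases "P j = 0")
      case False
      hence "a j \<le> P j * (1 / (real (Suc N) * P j))"
        unfolding a_def using P(1,2)[of j] by (intro mult_left_mono neg_ln_gap_bounds) auto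
      thus ?thesis using False by (simp add: n_def)
    qed (use n in \<open>simp add: a_def\<close>)
    have a2: "a j \<le> ((1 + 1 / d) * n powr (- d) * L) * real j powr (- s)" if "j \<ge> 1" for j
    proof (cases "P j = 0")
      case False
      hence "a j \<le> P j * ((1 + 1 / d) * (real (Suc N) * P j) powr (- d))"
        unfolding a_def using P(1,2)[of j] d by (intro mult_left_mono neg_ln_gap_le_powr) auto
      also have "\<dots> = (1 + 1 / d) * n powr (- d) * P j powr (1 - d)"
        using False P(1)[of j] n by (simp add: n_def powr_mult powr_diff powr_minus divide_inverse)
      also have "P j powr (1 - d) \<le> L * real j powr (- s)"
        unfolding L_def s_def
        by (rule summable_powr_of_tail(2)) (use P \<alpha> d s that in \<open>auto simp: s_def\<close>)
      finally show ?thesis using d by (simp add: mult_left_mono mult.assoc)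
    qed (use d in \<open>simp add: a_def L_def\<close>)
    have "suminf a \<le> real (Suc J) * (1 / n) + ((1 + 1 / d) * n powr (- d) * L) * (real J powr (1 - s) / (s - 1))"
      by (rule suminf_le_initial_tail(2)[OF s J0 a0 a1 a2])
    also have "\<dots> \<le> 3 * n powr \<alpha> * (1 / n) + ((1 + 1 / d) * n powr (- d) * L) * (n powr (\<alpha> * (1 - s)) / (s - 1))"
    proof (intro add_mono mult_left_mono mult_right_mono divide_right_mono)
      show "real (Suc J) \<le> 3 * n powr \<alpha>" using J n\<alpha> by simp
      have "real J powr (1 - s) \<le> (n powr \<alpha>) powr (1 - s)"
        using J n\<alpha> s by (intro powr_mono2') auto
      thus "real J powr (1 - s) \<le> n powr (\<alpha> * (1 - s))" by (simp add: powr_powr)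
    qed (use n s d in \<open>auto simp: L_def\<close>)
    also have "n powr \<alpha> * (1 / n) = n powr (\<alpha> - 1)" using n by (simp add: powr_diff)
    hence "3 * n powr \<alpha> * (1 / n) = 3 * n powr (\<alpha> - 1)" by simp
    \<comment> \<open>The tail exponent exceeds \<open>\<alpha> - 1\<close> by exactly
      \<open>d\<close>, which cancels the factor \<open>n powr (- d)\<close>.\<close>
    also have "\<alpha> * (1 - s) = \<alpha> - 1 + d" using \<alpha> by (simp add: s_def field_simps)
    also have "n powr (\<alpha> - 1 + d) = n powr (\<alpha> - 1) * n powr d" by (simp add: powr_add)
    also have "((1 + 1 / d) * n powr (- d) * L) * (n powr (\<alpha> - 1) * n powr d / (s - 1)) =
        (n powr (- d) * n powr d) * ((1 + 1 / d) * L / (s - 1) * n powr (\<alpha> - 1))" by simp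
    also have "n powr (- d) * n powr d = 1" using n by (simp add: powr_minus)
    finally show ?thesis by (simp add: a_def[abs_def] n_def algebra_simps)
  qed
  thus ?thesis by blast
qed

subsection \<open>The estimator\<close>

text \<open>Both the sample and the coordinates of \<open>Pi_pmf\<close> are independent with
  marginal \<open>p\<close>, so their restrictions to \<open>{1..n}\<close> have the same product
  law. As \<open>F\<close> sees only these coordinates, the default \<open>d\<close> is
  arbitrary.\<close>

lemma iid_sample_expectation:
  fixes F :: "(nat \<Rightarrow> nat) \<Rightarrow> real"
  assumes "iid_sample M p n X" "n \<ge> 1"
    and F: "\<And>x y. (\<And>i. i \<in> {1..n} \<Longrightarrow> x i = y i) \<Longrightarrow> F x = F y"
  shows "prob_space.expectation M (\<lambda>\<omega>. F (\<lambda>i. X i \<omega>)) =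
    measure_pmf.expectation (Pi_pmf {1..n} d (\<lambda>_. p)) F"
proof -
  let ?I = "{1..n}" and ?S = "\<lambda>_::nat. count_space (UNIV :: nat set)"
  interpret prob_space M using assms(1) by (simp add: iid_sample_def)
  have ind: "indep_vars ?S X ?I" and d: "\<And>i. i \<in> ?I \<Longrightarrow> distr M (count_space UNIV) (X i) = measure_pmf p"
    using assms(1) by (auto simp: iid_sample_def)
  have rv: "random_variable (count_space UNIV) (X i)" if "i \<in> ?I" for i
    using ind that by (auto simp: indep_vars_def)
  define Q where "Q = Pi_pmf ?I d (\<lambda>_. p)"
  have "distr M (PiM ?I ?S) (\<lambda>x. \<lambda>i\<in>?I. X i x) = PiM ?I (\<lambda>i. distr M (count_space UNIV) (X i))"
    using indep_vars_iff_distr_eq_PiM'[where I = ?I and M' = ?S and X = X] ind rv assms(2) by auto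
  also have "\<dots> = PiM ?I (\<lambda>i. measure_pmf p)"
    using d by (intro PiM_cong) auto
  also have "\<dots> = PiM ?I (\<lambda>i. distr (measure_pmf Q) (count_space UNIV) (\<lambda>x. x i))"
    by (intro PiM_cong) (auto simp: Q_def Pi_pmf_component simp flip: map_pmf_rep_eq)
  also have "\<dots> = distr (measure_pmf Q) (PiM ?I ?S) (\<lambda>x. \<lambda>i\<in>?I. x i)"
    using prob_space.indep_vars_iff_distr_eq_PiM'[OF measure_pmf.prob_space_axioms[of Q], where I = ?I and M' = ?S
        and X = "\<lambda>i x. x i"]
      indep_vars_Pi_pmf[of ?I d "\<lambda>_. p"] assms(2) unfolding Q_def by auto
  finally have eq: "distr M (PiM ?I ?S) (\<lambda>x. \<lambda>i\<in>?I. X i x) =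
    distr (measure_pmf Q) (PiM ?I ?S) (\<lambda>x. \<lambda>i\<in>?I. x i)" .
  \<comment> \<open>A finite product of countable discrete spaces is discrete, so every function on
    it is measurable.\<close>
  have mF: "F \<in> borel_measurable (PiM ?I ?S)"
    by (subst count_space_PiM_finite) auto
  have "prob_space.expectation M (\<lambda>\<omega>. F (\<lambda>i. X i \<omega>)) = expectation (\<lambda>\<omega>. F (\<lambda>i\<in>?I. X i \<omega>))"
    by (intro Bochner_Integration.integral_cong F) auto
  also have "\<dots> = integral\<^sup>L (distr M (PiM ?I ?S) (\<lambda>x. \<lambda>i\<in>?I. X i x)) F"
    by (subst integral_distr[OF _ mF]) (auto intro!: measurable_restrict rv)
  also have "\<dots> = measure_pmf.expectation Q (\<lambda>x. F (\<lambda>i\<in>?I. x i))"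
    unfolding eq by (subst integral_distr[OF _ mF]) (auto simp: space_PiM)
  also have "\<dots> = measure_pmf.expectation Q F"
    by (intro Bochner_Integration.integral_cong F) auto
  finally show ?thesis by (simp add: Q_def)
qed

text \<open>Coordinate \<open>i\<close> is drawn first; given its value \<open>j\<close>, the number
  of other coordinates equal to \<open>j\<close> is binomial.\<close>

lemma expectation_leave_one_out_count:
  fixes \<phi> :: "nat \<Rightarrow> real"
  assumes "finite A" "i \<in> A"
  shows "measure_pmf.expectation (Pi_pmf A d (\<lambda>_. p)) (\<lambda>x. \<phi> (card {k\<in>A - {i}. x k = x i})) =
    measure_pmf.expectation p (\<lambda>j. measure_pmf.expectation (binomial_pmf (card A - 1) (pmf p j)) \<phi>)"
proof -
  define B where "B = A - {i}"
  have B: "finite B" "i \<notin> B" "A = insert i B" "card B = card A - 1" using assms by (auto simp: B_def)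
  \<comment> \<open>Only finitely many counts occur, so an arbitrary \<open>\<phi>\<close> is
    bounded along them.\<close>
  have bound: "\<bar>\<phi> (card {k\<in>B. x k = x i})\<bar> \<le> (\<Sum>b\<le>card B. \<bar>\<phi> b\<bar>)" for x :: "'a \<Rightarrow> 'b"
    by (rule member_le_sum) (simp_all add: card_mono \<open>finite B\<close>)
  have "measure_pmf.expectation (Pi_pmf A d (\<lambda>_. p)) (\<lambda>x. \<phi> (card {k\<in>B. x k = x i})) =
    measure_pmf.expectation p (\<lambda>j. measure_pmf.expectation (Pi_pmf B d (\<lambda>_. p))
      (\<lambda>x. \<phi> (card {k\<in>B. (x(i := j)) k = (x(i := j)) i})))"
    unfolding B(3) by (rule expectation_Pi_pmf_insert(2)[OF B(1,2) bound])
  also have "\<dots> = measure_pmf.expectation p (\<lambda>j. measure_pmf.expectation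
      (map_pmf (\<lambda>x. card {k\<in>B. x k = j}) (Pi_pmf B d (\<lambda>_. p))) \<phi>)"
  proof -
    have "{k\<in>B. (x(i := j)) k = (x(i := j)) i} = {k\<in>B. x k = j}" for x :: "'a \<Rightarrow> 'b" and j
      using B(2) by auto
    thus ?thesis by simp
  qed
  finally show ?thesis unfolding count_Pi_pmf_binomial[OF B(1)] B(4) unfolding B_def .
qed

text \<open>Restoring \<open>i\<close> raises the count of each point of its matching set
  \<open>D\<close> by one, so each gains \<open>1 / card D\<close>. These gains add up to exactly 1
  unless \<open>D\<close> is empty, and \<open>i\<close> itself contributes
  \<open>harm (card D)\<close>.\<close>

lemma harm_count_delete:
  fixes x :: "'a \<Rightarrow> 'b"
  assumes "finite A" "i \<in> A"
  shows "(\<Sum>k\<in>A. harm (card {l\<in>A. x l = x k} - 1)) =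
    (\<Sum>k\<in>A - {i}. harm (card {l\<in>A - {i}. x l = x k} - 1))
    + harm (card {l\<in>A - {i}. x l = x i}) + (if {l\<in>A - {i}. x l = x i} = {} then 0 else 1 :: real)"
proof -
  define B where "B = A - {i}"
  define D where "D = {l\<in>B. x l = x i}"
  have B: "finite B" "i \<notin> B" "A = insert i B" and D: "finite D" "D \<subseteq> B"
    using assms by (auto simp: B_def D_def)
  have c: "harm (card {l\<in>A. x l = x k} - 1) - harm (card {l\<in>B. x l = x k} - 1) =
      (if k \<in> D then 1 / real (card D) else 0 :: real)" if "k \<in> B" for k
  proof (cases "x k = x i")
    case True
    have s: "{l\<in>A. x l = x k} = insert i D" "{l\<in>B. x l = x k} = D"
      unfolding True using B(3) by (auto simp: D_def)
    have k: "k \<in> D" using that True by (simp add: D_def)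
    hence "card D > 0" using D(1) card_gt_0_iff by blast
    then obtain m where m: "card D = Suc m" by (cases "card D") auto
    have "card (insert i D) = Suc (Suc m)" using D B(2) m by (subst card_insert_disjoint) auto
    thus ?thesis unfolding s using k m by (simp add: harm_Suc inverse_eq_divide)
  next
    case False
    hence "{l\<in>A. x l = x k} = {l\<in>B. x l = x k}" unfolding B(3) by auto
    moreover have "k \<notin> D" using False by (simp add: D_def)
    ultimately show ?thesis by simp
  qed
  have i: "{l\<in>A. x l = x i} = insert i D" "i \<notin> D" using B by (auto simp: D_def)
  have "(\<Sum>k\<in>B. harm (card {l\<in>A. x l = x k} - 1)) - (\<Sum>k\<in>B. harm (card {l\<in>B. x l = x k} - 1))
    = (\<Sum>k\<in>B. if k \<in> D then 1 / real (card D) else 0 :: real)"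
    unfolding sum_subtractf[symmetric] by (rule sum.cong[OF refl c])
  also have "\<dots> = (if D = {} then 0 else 1)"
  proof -
    have "(\<Sum>k\<in>B. if k \<in> D then 1 / real (card D) else 0) = (\<Sum>k\<in>B \<inter> D. 1 / real (card D))"
      by (rule sum.inter_restrict[OF B(1), symmetric])
    also have "B \<inter> D = D" using D(2) by blast
    finally show ?thesis using D(1) by simp
  qed
  finally have "(\<Sum>k\<in>B. harm (card {l\<in>A. x l = x k} - 1)) =
     (\<Sum>k\<in>B. harm (card {l\<in>B. x l = x k} - 1)) + (if D = {} then 0 else 1 :: real)"
    by linarith
  moreover have "(\<Sum>k\<in>A. harm (card {l\<in>A. x l = x k} - 1)) =
     harm (card {l\<in>A. x l = x i} - 1) + (\<Sum>k\<in>B. harm (card {l\<in>A. x l = x k} - 1) :: real)"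
    unfolding B_def by (rule sum.remove[OF assms])
  moreover have "harm (card {l\<in>A. x l = x i} - 1) = (harm (card D) :: real)" using i D(1) by simp
  ultimately show ?thesis unfolding D_def B_def by linarith
qed

lemma sample_multiplicity_eq_card:
  assumes "i \<in> {1..n}"
  shows "sample_multiplicity n x i - 1 = card {k\<in>{1..n} - {i}. x k = x i}"
proof -
  have "sample_multiplicity n x i = card {k\<in>{1..n}. x k = x i}"
    by (simp add: sample_multiplicity_def sum.If_cases Int_def)
  also have "{k\<in>{1..n}. x k = x i} = insert i {k\<in>{1..n} - {i}. x k = x i}"
    using assms by auto
  finally show ?thesis by simp
qed

lemma harmonic_entropy_estimator_eq:
  "harmonic_entropy_estimator n x =
    (1 / real n) * (\<Sum>i\<in>{1..n}. harm (n - 1) - harm (card {k\<in>{1..n} - {i}. x k = x i}))"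
  unfolding harmonic_entropy_estimator_def
  by (intro arg_cong[where f = "(*) (1 / real n)"] sum.cong refl) (simp only: sample_multiplicity_eq_card)

text \<open>Efron-Stein bounds the variance by squared deletion effects, each controlled by a
  leave-one-out count. The resulting binomial mean is the same for every \<open>i\<close>, hence the
  factor \<open>card A\<close>.\<close>

lemma variance_harmonic_sum_le:
  fixes p :: "'b pmf" and A :: "'a set"
  defines "f \<equiv> \<lambda>A x. \<Sum>i\<in>A. harm (card A - 1) - (harm (card {k\<in>A - {i}. x k = x i}) :: real)"
  assumes "finite A"
  shows "measure_pmf.expectation (Pi_pmf A d (\<lambda>_. p))
      (\<lambda>x. (f A x - measure_pmf.expectation (Pi_pmf A d (\<lambda>_. p)) (f A))\<^sup>2)
    \<le> real (card A) * measure_pmf.expectation p (\<lambda>j.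
      measure_pmf.expectation (binomial_pmf (card A - 1) (pmf p j))
        (\<lambda>b. (1 + (harm (card A - 1) - harm b))\<^sup>2))"
proof -
  let ?P = "Pi_pmf A d (\<lambda>_. p)"
  define N where "N = card A - 1"
  define T where "T B x = (\<Sum>k\<in>B. harm (card {l\<in>B. x l = x k} - 1) :: real)" for B and x :: "'a \<Rightarrow> 'b"
  \<comment> \<open>The constants are chosen so that \<open>f A x - g i x\<close> is
    \<open>harm N - harm (c x)\<close>, plus 1 exactly when no other point matches; it thus lies
    between 0 and \<open>1 + (harm N - harm (c x))\<close>.\<close>
  define g where "g i x = (real (card A) - 1) * harm N - 1 - T (A - {i}) x" for i and x :: "'a \<Rightarrow> 'b"
  have fT: "f A x = real (card A) * harm N - T A x" for x
  proof -
    have "card {l\<in>A. x l = x k} - 1 = card {l\<in>A - {k}. x l = x k}" if "k \<in> A" for k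
    proof -
      have "{l\<in>A. x l = x k} = insert k {l\<in>A - {k}. x l = x k}" using that by auto
      thus ?thesis using assms by simp
    qed
    thus ?thesis by (simp add: f_def T_def N_def sum_subtractf)
  qed
  have Tb: "0 \<le> T B x" "T B x \<le> real (card A) * harm N" if "B \<subseteq> A" for B x
  proof -
    show "0 \<le> T B x" unfolding T_def by (intro sum_nonneg harm_nonneg)
    have "T B x \<le> (\<Sum>k\<in>B. harm N)" unfolding T_def N_def
      by (intro sum_mono harm_mono diff_le_mono card_mono) (use assms that in auto)
    also have "\<dots> \<le> (\<Sum>k\<in>A. harm N)" using assms that by (intro sum_mono2) (auto simp: harm_nonneg)
    finally show "T B x \<le> real (card A) * harm N" by simp
  qed
  define C where "C = real (card A) * harm N + harm N + 1"
  have fb: "\<bar>f A x\<bar> \<le> C" for x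
    using Tb[of A x] harm_nonneg[of N, where 'a = real] by (simp add: fT C_def)
  have gb: "\<bar>g i x\<bar> \<le> C" if "i \<in> A" for i x
  proof -
    have "card A \<ge> 1" using assms that by (metis One_nat_def Suc_leI card_gt_0_iff empty_iff)
    hence "(real (card A) - 1) * harm N \<ge> 0" using harm_nonneg[of N, where 'a = real] by simp
    thus ?thesis using Tb[of "A - {i}" x] harm_nonneg[of N, where 'a = real]
      by (auto simp add: g_def C_def abs_le_iff algebra_simps)
  qed
  have "measure_pmf.expectation ?P (\<lambda>x. (f A x - measure_pmf.expectation ?P (f A))\<^sup>2)
    \<le> (\<Sum>i\<in>A. measure_pmf.expectation ?P (\<lambda>x. (f A x - g i x)\<^sup>2))"
  proof (rule efron_stein_Pi_pmf[OF \<open>finite A\<close> fb gb])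
    fix i and x :: "'a \<Rightarrow> 'b" and y assume "i \<in> A"
    have "T (A - {i}) (x(i := y)) = T (A - {i}) x"
      unfolding T_def by (intro sum.cong refl arg_cong[where f = harm] arg_cong[where f = card]
          arg_cong[where f = "\<lambda>c. c - 1"] Collect_cong) auto
    thus "g i (x(i := y)) = g i x" by (simp add: g_def)
  qed
  also have "\<dots> \<le> (\<Sum>i\<in>A. measure_pmf.expectation p (\<lambda>j.
      measure_pmf.expectation (binomial_pmf N (pmf p j)) (\<lambda>b. (1 + (harm N - harm b))\<^sup>2)))"
  proof (rule sum_mono)
    fix i assume i: "i \<in> A"
    define c where "c x = card {k\<in>A - {i}. x k = x i}" for x :: "'a \<Rightarrow> 'b"
    have cN: "c x \<le> N" for x
    proof -
      have "c x \<le> card (A - {i})" unfolding c_def using \<open>finite A\<close> by (intro card_mono) auto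
      thus ?thesis using i by (simp add: N_def)
    qed
    have h: "0 \<le> harm N - (harm (c x) :: real)" "harm N - (harm (c x) :: real) \<le> harm N" for x
      using harm_mono[OF cN[of x], where 'a = real] harm_nonneg[of "c x", where 'a = real] by auto
    have "measure_pmf.expectation ?P (\<lambda>x. (f A x - g i x)\<^sup>2) \<le>
      measure_pmf.expectation ?P (\<lambda>x. (1 + (harm N - harm (c x)))\<^sup>2)"
    proof (rule expectation_pmf_mono)
      fix x
      have fg: "f A x - g i x = harm N - harm (c x) + (if {l\<in>A - {i}. x l = x i} = {} then 1 else 0)"
        using harm_count_delete[OF \<open>finite A\<close> i, of x]
        by (simp add: fT g_def T_def c_def algebra_simps)
      show le: "(f A x - g i x)\<^sup>2 \<le> (1 + (harm N - harm (c x)))\<^sup>2"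
        unfolding fg using h[of x] by (intro power_mono) auto
      have le': "(1 + (harm N - harm (c x)))\<^sup>2 \<le> (1 + harm N :: real)\<^sup>2"
        using h[of x] by (intro power_mono) auto
      show "\<bar>(1 + (harm N - harm (c x)))\<^sup>2\<bar> \<le> (1 + harm N :: real)\<^sup>2" using le' by simp
      show "\<bar>(f A x - g i x)\<^sup>2\<bar> \<le> (1 + harm N)\<^sup>2" using le le' by simp
    qed
    also have "\<dots> = measure_pmf.expectation p (\<lambda>j.
      measure_pmf.expectation (binomial_pmf N (pmf p j)) (\<lambda>b. (1 + (harm N - harm b))\<^sup>2))"
      unfolding c_def N_def by (rule expectation_leave_one_out_count[OF \<open>finite A\<close> i])
    finally show "measure_pmf.expectation ?P (\<lambda>x. (f A x - g i x)\<^sup>2) \<le> \<dots>" .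
  qed
  finally show ?thesis by (simp add: N_def)
qed

section \<open>Bias, variance and mean squared error of the estimator\<close>

lemma abs_harmonic_entropy_estimator_le:
  "\<bar>harmonic_entropy_estimator n x\<bar> \<le> harm (n - 1)"
proof (cases "n = 0")
  case False
  have "\<bar>\<Sum>i\<in>{1..n}. harm (n - 1) - (harm (card {k\<in>{1..n} - {i}. x k = x i}) :: real)\<bar>
    \<le> (\<Sum>i\<in>{1..n}. harm (n - 1))"
  proof (rule sum_abs[THEN order_trans], rule sum_mono)
    fix i assume i: "i \<in> {1..n}"
    have "card {k\<in>{1..n} - {i}. x k = x i} \<le> card ({1..n} - {i})" by (intro card_mono) auto
    also have "\<dots> = n - 1" using i by simp
    finally show "\<bar>harm (n - 1) - (harm (card {k\<in>{1..n} - {i}. x k = x i}) :: real)\<bar> \<le> harm (n - 1)"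
      using harm_mono[of "card {k\<in>{1..n} - {i}. x k = x i}" "n - 1", where 'a = real]
        harm_nonneg[of "card {k\<in>{1..n} - {i}. x k = x i}", where 'a = real] by simp
  qed
  thus ?thesis using False
    by (simp add: harmonic_entropy_estimator_eq abs_mult divide_le_eq mult.commute)
qed (simp add: harmonic_entropy_estimator_def harm_nonneg)

text \<open>All \<open>n\<close> summands have the same mean, so the factor \<open>1 / n\<close>
  cancels; conditioning on the \<open>i\<close>-th value reduces that mean to
  \<open>expectation_binomial_harm\<close>.\<close>

lemma expectation_harmonic_entropy_estimator:
  assumes "n \<ge> 1"
  shows "measure_pmf.expectation (Pi_pmf {1..n} d (\<lambda>_. p)) (harmonic_entropy_estimator n) =
    measure_pmf.expectation p (\<lambda>j. \<Sum>k=1..n - 1. (1 - pmf p j) ^ k / real k)"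
proof -
  let ?P = "Pi_pmf {1..n} d (\<lambda>_. p)"
  define c where "c i x = card {k\<in>{1..n} - {i}. x k = x i}" for i and x :: "nat \<Rightarrow> nat"
  have bound: "\<bar>harm (n - 1) - harm (c i x)\<bar> \<le> harm (n - 1) + (harm n :: real)" for i x
  proof -
    have "c i x \<le> card {1..n}" unfolding c_def by (intro card_mono) auto
    hence "harm (c i x) \<le> (harm n :: real)" by (intro harm_mono) simp
    thus ?thesis using harm_nonneg[of "c i x", where 'a = real]
        harm_nonneg[of "n - 1", where 'a = real] by simp
  qed
  have q: "pmf p j \<in> {0..1}" for j by (simp add: pmf_le_1)
  have "measure_pmf.expectation ?P (harmonic_entropy_estimator n) =
     (1 / real n) * (\<Sum>i\<in>{1..n}. measure_pmf.expectation ?P (\<lambda>x. harm (n - 1) - harm (c i x)))"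
    unfolding harmonic_entropy_estimator_eq[abs_def] c_def[symmetric]
    unfolding integral_mult_right_zero
    by (intro arg_cong[where f = "(*) (1 / real n)"] Bochner_Integration.integral_sum
        integrable_pmf_bounded[OF bound])
  also have "\<dots> = (1 / real n) * (\<Sum>i\<in>{1..n}. measure_pmf.expectation p
      (\<lambda>j. \<Sum>k=1..n - 1. (1 - pmf p j) ^ k / real k))"
  proof (intro arg_cong[where f = "(*) (1 / real n)"] sum.cong refl)
    fix i assume i: "i \<in> {1..n}"
    have "measure_pmf.expectation ?P (\<lambda>x. harm (n - 1) - harm (c i x) :: real) = measure_pmf.expectation p
      (\<lambda>j. measure_pmf.expectation (binomial_pmf (n - 1) (pmf p j)) (\<lambda>b. harm (n - 1) - harm b))"
      unfolding c_def
      using expectation_leave_one_out_count[OF _ i, where \<phi> = "\<lambda>b. harm (n - 1) - harm b"] by simp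
    also have "\<dots> = measure_pmf.expectation p (\<lambda>j. \<Sum>k=1..n - 1. (1 - pmf p j) ^ k / real k)"
    proof (intro integral_cong_AE AE_pmfI)
      fix j assume "j \<in> set_pmf p"
      hence "pmf p j \<in> {0<..1}" by (simp add: pmf_le_1 pmf_positive)
      from expectation_binomial_harm[OF this, of "n - 1"]
      show "measure_pmf.expectation (binomial_pmf (n - 1) (pmf p j)) (\<lambda>b. harm (n - 1) - harm b) =
          (\<Sum>k=1..n - 1. (1 - pmf p j) ^ k / real k)" using q by simp
    qed auto
    finally show "measure_pmf.expectation ?P (\<lambda>x. harm (n - 1) - harm (c i x)) = \<dots>" .
  qed
  finally show ?thesis using assms by simp
qed

lemma harmonic_entropy_estimator_bias:
  assumes \<alpha>: "0 < \<alpha>" "\<alpha> < 1"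
    and tail: "\<And>j. j \<ge> 1 \<Longrightarrow> pmf p j \<le> C0 * real j powr (- 1 / \<alpha>)"
  shows "\<exists>C. \<forall>n\<ge>1. \<bar>measure_pmf.expectation (Pi_pmf {1..n} d (\<lambda>_. p)) (harmonic_entropy_estimator n)
     - shannon_entropy p\<bar> \<le> C * real n powr (\<alpha> - 1)"
proof -
  define t where "t = (1 - \<alpha>) / 2"
  have t: "0 < t" "t < 1" "(1 - t) / \<alpha> > 1" using \<alpha> by (auto simp: t_def field_simps)
  have S: "summable (\<lambda>j. pmf p j powr (1 - t))"
    by (rule summable_powr_of_tail(1)[OF _ tail]) (use \<alpha> t in auto)
  \<comment> \<open>The bound \<open>ln x \<le> x powr t / t\<close> at
    \<open>x = 1 / pmf p j\<close>; with \<open>S\<close> it makes the entropy series converge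
    absolutely.\<close>
  have le: "\<bar>pmf p j * - ln (pmf p j)\<bar> \<le> pmf p j powr (1 - t) / t" for j
  proof (cases "pmf p j = 0")
    case False
    hence P: "0 < pmf p j" "pmf p j \<le> 1" by (auto simp: pmf_le_1 less_le)
    have "- ln (pmf p j) \<le> (1 / pmf p j) powr t / t"
      using ln_powr_bound[of "1 / pmf p j" t] P t by (simp add: ln_div)
    hence "pmf p j * - ln (pmf p j) \<le> pmf p j * ((1 / pmf p j) powr t / t)"
      using P by (intro mult_left_mono) auto
    also have "\<dots> = pmf p j powr (1 - t) / t" using P by (simp add: powr_diff powr_divide)
    finally have "pmf p j * - ln (pmf p j) \<le> pmf p j powr (1 - t) / t" .
    moreover have "0 \<le> pmf p j * - ln (pmf p j)" using P by (intro mult_nonneg_nonneg) simp_all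
    ultimately show ?thesis by linarith
  qed simp
  have ent: "summable (\<lambda>j. \<bar>pmf p j * - ln (pmf p j)\<bar>)"
    by (rule summable_comparison_test'[OF summable_divide[OF S, of t], of 0]) (use le in simp)
  have "\<exists>C. \<forall>N. (\<Sum>j. pmf p j * (- ln (pmf p j) - (\<Sum>k=1..N. (1 - pmf p j) ^ k / real k)))
    \<le> C * real (Suc N) powr (\<alpha> - 1)"
    by (rule neg_ln_gap_series_le[OF _ _ tail \<alpha>]) (simp_all add: pmf_le_1)
  then obtain C where C: "\<And>N. (\<Sum>j. pmf p j * (- ln (pmf p j) - (\<Sum>k=1..N. (1 - pmf p j) ^ k / real k)))
    \<le> C * real (Suc N) powr (\<alpha> - 1)"
    by blast
  have "\<bar>measure_pmf.expectation (Pi_pmf {1..n} d (\<lambda>_. p)) (harmonic_entropy_estimator n)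
     - shannon_entropy p\<bar> \<le> C * real n powr (\<alpha> - 1)" if n: "n \<ge> 1" for n
  proof -
    define h where "h j = (\<Sum>k=1..n - 1. (1 - pmf p j) ^ k / real k)" for j
    have h0: "0 \<le> h j" for j unfolding h_def by (intro sum_nonneg) (simp add: pmf_le_1)
    have hln: "h j \<le> - ln (pmf p j)" if "pmf p j \<noteq> 0" for j
      unfolding h_def using that by (intro neg_ln_gap_bounds(1)) (auto simp: pmf_le_1 less_le)
    \<comment> \<open>The weighted gap is dominated by the entropy summand, hence summable as
      well.\<close>
    have gap: "0 \<le> pmf p j * (- ln (pmf p j) - h j)"
      "pmf p j * (- ln (pmf p j) - h j) \<le> \<bar>pmf p j * - ln (pmf p j)\<bar>" for j
    proof -
      have *: "0 \<le> pmf p j * (- ln (pmf p j) - h j) \<and>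
        pmf p j * (- ln (pmf p j) - h j) \<le> pmf p j * - ln (pmf p j)"
      proof (cases "pmf p j = 0")
        case False
        have "0 \<le> pmf p j * (- ln (pmf p j) - h j)"
          by (rule mult_nonneg_nonneg) (use hln[OF False] in simp_all)
        moreover have "pmf p j * (- ln (pmf p j) - h j) \<le> pmf p j * - ln (pmf p j)"
          by (rule mult_left_mono) (use h0[of j] in simp_all)
        ultimately show ?thesis ..
      qed simp
      thus "0 \<le> pmf p j * (- ln (pmf p j) - h j)"
        "pmf p j * (- ln (pmf p j) - h j) \<le> \<bar>pmf p j * - ln (pmf p j)\<bar>" by linarith+
    qed
    have "summable (\<lambda>j. \<bar>pmf p j * (- ln (pmf p j) - h j)\<bar>)"
      by (rule summable_comparison_test'[OF ent, of 0]) (use gap in simp)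
    note G = expectation_pmf_nat[OF this]
    have L: "integrable (measure_pmf p) (\<lambda>j. - ln (pmf p j))"
      by (rule expectation_pmf_nat(1)[OF ent])
    \<comment> \<open>Writing \<open>h\<close> as a difference of two integrable functions
      identifies the bias as minus the mean gap.\<close>
    have "measure_pmf.expectation p (\<lambda>j. - ln (pmf p j) - (- ln (pmf p j) - h j)) =
       measure_pmf.expectation p (\<lambda>j. - ln (pmf p j)) - measure_pmf.expectation p (\<lambda>j. - ln (pmf p j) - h j)"
      by (rule Bochner_Integration.integral_diff[OF L G(1)])
    hence "measure_pmf.expectation p h - shannon_entropy p =
       - (\<Sum>j. pmf p j * (- ln (pmf p j) - h j))"
      unfolding G(2) by (simp add: shannon_entropy_def)
    moreover have "0 \<le> (\<Sum>j. pmf p j * (- ln (pmf p j) - h j))"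
      by (intro suminf_nonneg summable_comparison_test'[OF ent, of 0] gap) (use gap in simp)
    ultimately have "\<bar>measure_pmf.expectation p h - shannon_entropy p\<bar> =
       (\<Sum>j. pmf p j * (- ln (pmf p j) - h j))" by simp
    also have "\<dots> \<le> C * real n powr (\<alpha> - 1)" using C[of "n - 1"] n by (simp add: h_def)
    finally show ?thesis unfolding expectation_harmonic_entropy_estimator[OF n] h_def .
  qed
  thus ?thesis by blast
qed

text \<open>The binomial second moment at \<open>q = pmf p j\<close> is at most a constant times
  \<open>pmf p j powr (- t)\<close>. Averaged over \<open>p\<close> this becomes the sum of
  \<open>pmf p j powr (1 - t)\<close>, which is finite and independent of \<open>n\<close>.\<close>

lemma harmonic_entropy_estimator_variance:
  assumes \<alpha>: "0 < \<alpha>" "\<alpha> < 1"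
    and tail: "\<And>j. j \<ge> 1 \<Longrightarrow> pmf p j \<le> C0 * real j powr (- 1 / \<alpha>)"
  shows "\<exists>K. \<forall>n\<ge>1. measure_pmf.expectation (Pi_pmf {1..n} d (\<lambda>_. p)) (\<lambda>x.
      (harmonic_entropy_estimator n x -
       measure_pmf.expectation (Pi_pmf {1..n} d (\<lambda>_. p)) (harmonic_entropy_estimator n))\<^sup>2)
    \<le> K / real n"
proof -
  define t where "t = (1 - \<alpha>) / 2"
  have t: "0 < t" "t < 1" "(1 - t) / \<alpha> > 1" using \<alpha> by (auto simp: t_def field_simps)
  have S: "summable (\<lambda>j. pmf p j powr (1 - t))"
    by (rule summable_powr_of_tail(1)[OF _ tail]) (use \<alpha> t in auto)
  have eq: "pmf p j * (2 * (5 / t)\<^sup>2 * pmf p j powr (- t)) = 2 * (5 / t)\<^sup>2 * pmf p j powr (1 - t)" for j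
    by (cases "pmf p j = 0") (simp_all add: powr_diff powr_minus divide_inverse)
  have "summable (\<lambda>j. \<bar>pmf p j * (2 * (5 / t)\<^sup>2 * pmf p j powr (- t))\<bar>)"
    unfolding eq by (simp only: abs_of_nonneg zero_le_mult_iff powr_ge_zero zero_le_power2 zero_le_numeral simp_thms)
      (intro summable_mult S)
  note int = expectation_pmf_nat(1)[OF this]
  define K where "K = measure_pmf.expectation p (\<lambda>j. 2 * (5 / t)\<^sup>2 * pmf p j powr (- t))"
  have "measure_pmf.expectation (Pi_pmf {1..n} d (\<lambda>_. p)) (\<lambda>x.
      (harmonic_entropy_estimator n x -
       measure_pmf.expectation (Pi_pmf {1..n} d (\<lambda>_. p)) (harmonic_entropy_estimator n))\<^sup>2)
    \<le> K / real n" if n: "n \<ge> 1" for n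
  proof -
    let ?P = "Pi_pmf {1..n} d (\<lambda>_. p)"
    define f where "f x = (\<Sum>i\<in>{1..n}. harm (n - 1) -
      (harm (card {k\<in>{1..n} - {i}. x k = x i}) :: real))" for x :: "nat \<Rightarrow> nat"
    have est: "harmonic_entropy_estimator n = (\<lambda>x. (1 / real n) * f x)"
      by (rule ext) (simp only: harmonic_entropy_estimator_eq f_def)
    have "measure_pmf.expectation ?P (\<lambda>x. (f x - measure_pmf.expectation ?P f)\<^sup>2)
      \<le> real n * measure_pmf.expectation p (\<lambda>j.
        measure_pmf.expectation (binomial_pmf (n - 1) (pmf p j)) (\<lambda>b. (1 + (harm (n - 1) - harm b))\<^sup>2))"
      using variance_harmonic_sum_le[of "{1..n}" d p] unfolding f_def[abs_def] by simp
    also have "\<dots> \<le> real n * K"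
      unfolding K_def
    proof (intro mult_left_mono integral_mono_AE'[OF int] AE_pmfI)
      fix j assume "j \<in> set_pmf p"
      hence "pmf p j \<in> {0<..1}" by (simp add: pmf_le_1 pmf_positive)
      thus "measure_pmf.expectation (binomial_pmf (n - 1) (pmf p j)) (\<lambda>b. (1 + (harm (n - 1) - harm b))\<^sup>2)
        \<le> 2 * (5 / t)\<^sup>2 * pmf p j powr (- t)"
        using t by (intro expectation_binomial_square_harm_diff) auto
    qed auto
    finally have V: "measure_pmf.expectation ?P (\<lambda>x. (f x - measure_pmf.expectation ?P f)\<^sup>2) \<le> real n * K" .
    have "measure_pmf.expectation ?P (\<lambda>x. ((1 / real n) * f x - measure_pmf.expectation ?P (\<lambda>x. (1 / real n) * f x))\<^sup>2)
      = (1 / real n)\<^sup>2 * measure_pmf.expectation ?P (\<lambda>x. (f x - measure_pmf.expectation ?P f)\<^sup>2)"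
      unfolding integral_mult_right_zero right_diff_distrib[symmetric] power_mult_distrib ..
    \<comment> \<open>The unnormalised sum has variance at most \<open>n * K\<close>; dividing by
      the square of \<open>n\<close> leaves \<open>K / n\<close>.\<close>
    also have "\<dots> \<le> (1 / real n)\<^sup>2 * (real n * K)" using V by (intro mult_left_mono) auto
    also have "\<dots> = K / real n" using n by (simp add: power2_eq_square)
    finally show ?thesis unfolding est .
  qed
  thus ?thesis by blast
qed

lemma harmonic_entropy_estimator_mse:
  assumes \<alpha>: "0 < \<alpha>" "\<alpha> < 1"
    and tail: "\<And>j. j \<ge> 1 \<Longrightarrow> pmf p j \<le> C0 * real j powr (- 1 / \<alpha>)"
  shows "\<exists>C>0. \<forall>n\<ge>1. \<forall>M X. iid_sample M p n X \<longrightarrow>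
    prob_space.expectation M (\<lambda>\<omega>. (harmonic_entropy_estimator n (\<lambda>i. X i \<omega>) - shannon_entropy p)\<^sup>2)
    \<le> C * (1 / real n powr (2 * (1 - \<alpha>)) + 1 / real n)"
proof -
  let ?E = "\<lambda>n. measure_pmf.expectation (Pi_pmf {1..n} 0 (\<lambda>_. p))"
  obtain B where B: "\<And>n. n \<ge> 1 \<Longrightarrow>
      \<bar>?E n (harmonic_entropy_estimator n) - shannon_entropy p\<bar> \<le> B * real n powr (\<alpha> - 1)"
    using harmonic_entropy_estimator_bias[OF \<alpha> tail] by blast
  obtain K where K: "\<And>n. n \<ge> 1 \<Longrightarrow>
      ?E n (\<lambda>x. (harmonic_entropy_estimator n x - ?E n (harmonic_entropy_estimator n))\<^sup>2) \<le> K / real n"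
    using harmonic_entropy_estimator_variance[OF \<alpha> tail] by blast
  \<comment> \<open>The constant dominates both the variance factor and the squared bias factor; the
    added 1 keeps it positive.\<close>
  have "prob_space.expectation M (\<lambda>\<omega>. (harmonic_entropy_estimator n (\<lambda>i. X i \<omega>) - shannon_entropy p)\<^sup>2)
    \<le> (\<bar>K\<bar> + B\<^sup>2 + 1) * (1 / real n powr (2 * (1 - \<alpha>)) + 1 / real n)"
    if n: "n \<ge> 1" and M: "iid_sample M p n X" for n X and M :: "'b measure"
  proof -
    have cong: "harmonic_entropy_estimator n x = harmonic_entropy_estimator n y"
      if "\<And>i. i \<in> {1..n} \<Longrightarrow> x i = y i" for x y
    proof -
      have "sample_multiplicity n x i = sample_multiplicity n y i" if "i \<in> {1..n}" for i
        unfolding sample_multiplicity_def using \<open>\<And>i. i \<in> {1..n} \<Longrightarrow> x i = y i\<close> that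
        by (intro sum.cong) auto
      thus ?thesis unfolding harmonic_entropy_estimator_def by simp
    qed
    have "(?E n (harmonic_entropy_estimator n) - shannon_entropy p)\<^sup>2 \<le> (B * real n powr (\<alpha> - 1))\<^sup>2"
      using power_mono[OF B[OF n], of 2] by simp
    also have "\<dots> = B\<^sup>2 * real n powr (2 * (\<alpha> - 1))"
      by (simp add: power_mult_distrib power2_eq_square flip: powr_add)
    also have "2 * (\<alpha> - 1) = - (2 * (1 - \<alpha>))" by simp
    also have "real n powr \<dots> = 1 / real n powr (2 * (1 - \<alpha>))"
      by (simp only: powr_minus_divide)
    finally have bias: "(?E n (harmonic_entropy_estimator n) - shannon_entropy p)\<^sup>2
      \<le> B\<^sup>2 * (1 / real n powr (2 * (1 - \<alpha>)))" .
    have "prob_space.expectation M (\<lambda>\<omega>. (harmonic_entropy_estimator n (\<lambda>i. X i \<omega>) - shannon_entropy p)\<^sup>2)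
       = ?E n (\<lambda>x. (harmonic_entropy_estimator n x - shannon_entropy p)\<^sup>2)"
      by (rule iid_sample_expectation[OF M n])
        (rule arg_cong[where f = "\<lambda>u. (u - shannon_entropy p)\<^sup>2"], rule cong)
    also have "\<dots> = ?E n (\<lambda>x. (harmonic_entropy_estimator n x - ?E n (harmonic_entropy_estimator n))\<^sup>2)
       + (?E n (harmonic_entropy_estimator n) - shannon_entropy p)\<^sup>2"
      by (rule expectation_square_pmf[OF abs_harmonic_entropy_estimator_le])
    also have "\<dots> \<le> \<bar>K\<bar> * (1 / real n) + B\<^sup>2 * (1 / real n powr (2 * (1 - \<alpha>)))"
      by (intro add_mono bias order_trans[OF K[OF n]]) (simp add: divide_right_mono)
    also have "\<dots> \<le> (\<bar>K\<bar> + B\<^sup>2 + 1) * (1 / real n) + (\<bar>K\<bar> + B\<^sup>2 + 1) * (1 / real n powr (2 * (1 - \<alpha>)))"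
      by (intro add_mono mult_right_mono) auto
    finally show ?thesis by (simp add: algebra_simps)
  qed
  moreover have "\<bar>K\<bar> + B\<^sup>2 + 1 > 0" by (simp add: add_nonneg_pos)
  ultimately show ?thesis by blast
qed

section \<open>The case \<alpha> = 0 and the conclusion\<close>

lemma smallo_powr_bound:
  fixes f :: "nat \<Rightarrow> real"
  assumes "f \<in> o(\<lambda>j. real j powr s)"
  shows "\<exists>C. \<forall>j\<ge>1. f j \<le> C * real j powr s"
proof -
  have "eventually (\<lambda>j. norm (f j) \<le> 1 * norm (real j powr s)) at_top"
    by (rule landau_o.smallD[OF assms]) simp
  then obtain J where J: "\<And>j. j \<ge> J \<Longrightarrow> \<bar>f j\<bar> \<le> real j powr s"
    by (auto simp: eventually_at_top_linorder)
  \<comment> \<open>The summand 1 serves all \<open>j \<ge> J\<close>; the finitely many ratios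
    below \<open>J\<close> are absorbed by their sum.\<close>
  define C where "C = 1 + (\<Sum>j<J. \<bar>f j\<bar> / real j powr s)"
  have "f j \<le> C * real j powr s" if "j \<ge> 1" for j
  proof (cases "j < J")
    case True
    have "\<bar>f j\<bar> / real j powr s \<le> (\<Sum>j<J. \<bar>f j\<bar> / real j powr s)"
      by (rule member_le_sum) (use True in auto)
    hence "\<bar>f j\<bar> / real j powr s \<le> C" by (simp add: C_def)
    hence "\<bar>f j\<bar> \<le> C * real j powr s" using that by (simp add: divide_le_eq)
    thus ?thesis by linarith
  next
    case False
    have "1 \<le> C" unfolding C_def by (simp add: sum_nonneg)
    hence "1 * real j powr s \<le> C * real j powr s" by (intro mult_right_mono) auto
    thus ?thesis using J[of j] False by simp
  qed
  thus ?thesis by blast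
qed

theorem mainTheorem3:
  fixes \<alpha> :: real and p :: "nat pmf"
  assumes "0 \<le> \<alpha>" and "\<alpha> < 1"
    and "pmf_on_positives p"
    and "tail_condition \<alpha> p"
  shows "\<exists>C::real. C > 0 \<and>
    (\<forall>n\<ge>1. \<forall>(M :: 'a measure) X. iid_sample M p n X \<longrightarrow>
      prob_space.expectation M
        (\<lambda>\<omega>. (harmonic_entropy_estimator n (\<lambda>i. X i \<omega>) - shannon_entropy p)\<^sup>2)
      \<le> C * (1 / real n powr (2 * (1 - \<alpha>)) + 1 / real n))"
proof (cases "\<alpha> = 0")
  case True
  hence "\<forall>\<beta>. 0 < \<beta> \<and> \<beta> < 1 \<longrightarrow> (\<lambda>j. pmf p j) \<in> o(\<lambda>j. real j powr (- 1 / \<beta>))"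
    using assms(4) by (simp add: tail_condition_def)
  from this[rule_format, of "1 / 2"]
  have "(\<lambda>j. pmf p j) \<in> o(\<lambda>j. real j powr (- 1 / (1 / 2)))" by simp
  then obtain C0 where C0: "\<And>j. j \<ge> 1 \<Longrightarrow> pmf p j \<le> C0 * real j powr (- 1 / (1 / 2))"
    using smallo_powr_bound by blast
  obtain C where C: "C > 0" "\<And>n X. \<And>M :: 'a measure. n \<ge> 1 \<Longrightarrow> iid_sample M p n X \<Longrightarrow>
    prob_space.expectation M (\<lambda>\<omega>. (harmonic_entropy_estimator n (\<lambda>i. X i \<omega>) - shannon_entropy p)\<^sup>2)
    \<le> C * (1 / real n powr (2 * (1 - 1 / 2)) + 1 / real n)"
    using harmonic_entropy_estimator_mse[of "1 / 2" p C0, OF _ _ C0] by (simp only:) auto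
  show ?thesis
  proof (intro exI[of _ "2 * C"] conjI allI impI)
    fix n X and M :: "'a measure" assume n: "1 \<le> n" and M: "iid_sample M p n X"
    \<comment> \<open>At exponent 1/2 both rates equal \<open>1 / n\<close>, which explains the
      factor 2; the target rate is at least its own summand \<open>1 / n\<close>.\<close>
    have "C * (1 / real n powr (2 * (1 - 1 / 2)) + 1 / real n) = 2 * C * (1 / real n)"
      using n by simp
    also have "\<dots> \<le> 2 * C * (1 / real n powr (2 * (1 - \<alpha>)) + 1 / real n)"
      using C(1) by (intro mult_left_mono) auto
    finally show "prob_space.expectation M
        (\<lambda>\<omega>. (harmonic_entropy_estimator n (\<lambda>i. X i \<omega>) - shannon_entropy p)\<^sup>2) \<le> \<dots>"
      using C(2)[OF n M] by linarith
  qed (use C(1) in simp)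
next
  case False
  then obtain C0 where "\<And>j. j \<ge> 1 \<Longrightarrow> pmf p j \<le> C0 * real j powr (- 1 / \<alpha>)"
    using assms(4) unfolding tail_condition_def by auto
  thus ?thesis using False assms(1,2) by (intro harmonic_entropy_estimator_mse) auto
qed

end
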